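(* Let $n\ge m\ge 1$ and let $H(z)=\sum_{j=0}^n A_j z^j+\sum_{j=0}^m B_j\overline{z}^{\,j}$, where $A_0,\dots,A_n,B_0,\dots,B_m$ are mutually independent complex Gaussian random variables with $\mathbb{E}A_j=\mathbb{E}B_j=0$, $\mathbb{E}[A_j^2]=\mathbb{E}[B_j^2]=0$, $\mathbb{E}|A_j|^2=\alpha_j>0$ and $\mathbb{E}|B_j|^2=\beta_j>0$. Then for every open set $T\subseteq\mathbb{C}$, the expected number $\mathbb{E}N_H(T)$ of zeros of $H$ in $T$ equals $$\frac{1}{\pi}\int_T \frac{1}{|z|^2}\,\frac{r_1^2+r_2^2-2r_{12}^2}{r_3^2\sqrt{(r_1+r_2)^2-4r_{12}^2}}\,dA(z),$$ where, writing $s_k=\sum_{j=1}^n j^k\alpha_j|z|^{2j}$ and $t_k=\sum_{j=1}^m j^k\beta_j|z|^{2j}$, $$r_3=\sum_{j=0}^n\alpha_j|z|^{2j}+\sum_{j=0}^m\beta_j|z|^{2j},\quad r_{12}=s_1t_1,\quad r_1=r_3 s_2-s_1^2,\quad r_2=r_3 t_2-t_1^2.$$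
   Context: $dA$ denotes Lebesgue measure on $\mathbb{C}$; $N_H(T)$ is the number of points $z\in T$ with $H(z)=0$. *)

theory Defs
  imports "HOL-Probability.Probability"
begin

text \<open>Circularly-symmetric complex Gaussian with mean 0, E X^2 = 0, E|X|^2 = v:
  the law of X has Lebesgue density exp(-|z|^2/v)/(pi v) on the complex plane.\<close>
definition complex_gaussian :: "'a measure \<Rightarrow> ('a \<Rightarrow> complex) \<Rightarrow> real \<Rightarrow> bool" where
  "complex_gaussian M X v \<longleftrightarrow>
     distributed M lborel X (\<lambda>z. ennreal (exp (- ((cmod z)\<^sup>2) / v) / (pi * v)))"

definition harm_poly :: "nat \<Rightarrow> nat \<Rightarrow> (nat \<Rightarrow> complex) \<Rightarrow> (nat \<Rightarrow> complex) \<Rightarrow> complex \<Rightarrow> complex" where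
  "harm_poly n m a b z = (\<Sum>j\<le>n. a j * z ^ j) + (\<Sum>j\<le>m. b j * cnj z ^ j)"

definition num_zeros :: "(complex \<Rightarrow> complex) \<Rightarrow> complex set \<Rightarrow> ennreal" where
  "num_zeros H T = (if finite {z\<in>T. H z = 0} then of_nat (card {z\<in>T. H z = 0}) else \<infinity>)"

definition s_k :: "nat \<Rightarrow> (nat \<Rightarrow> real) \<Rightarrow> nat \<Rightarrow> complex \<Rightarrow> real" where
  "s_k n \<alpha> k z = (\<Sum>j=1..n. real j ^ k * \<alpha> j * cmod z ^ (2*j))"

definition r3 :: "nat \<Rightarrow> nat \<Rightarrow> (nat \<Rightarrow> real) \<Rightarrow> (nat \<Rightarrow> real) \<Rightarrow> complex \<Rightarrow> real" where
  "r3 n m \<alpha> \<beta> z = (\<Sum>j\<le>n. \<alpha> j * cmod z ^ (2*j)) + (\<Sum>j\<le>m. \<beta> j * cmod z ^ (2*j))"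

definition r12 :: "nat \<Rightarrow> nat \<Rightarrow> (nat \<Rightarrow> real) \<Rightarrow> (nat \<Rightarrow> real) \<Rightarrow> complex \<Rightarrow> real" where
  "r12 n m \<alpha> \<beta> z = s_k n \<alpha> 1 z * s_k m \<beta> 1 z"

definition r1 :: "nat \<Rightarrow> nat \<Rightarrow> (nat \<Rightarrow> real) \<Rightarrow> (nat \<Rightarrow> real) \<Rightarrow> complex \<Rightarrow> real" where
  "r1 n m \<alpha> \<beta> z = r3 n m \<alpha> \<beta> z * s_k n \<alpha> 2 z - (s_k n \<alpha> 1 z)^2"

definition r2 :: "nat \<Rightarrow> nat \<Rightarrow> (nat \<Rightarrow> real) \<Rightarrow> (nat \<Rightarrow> real) \<Rightarrow> complex \<Rightarrow> real" where
  "r2 n m \<alpha> \<beta> z = r3 n m \<alpha> \<beta> z * s_k m \<beta> 2 z - (s_k m \<beta> 1 z)^2"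

definition zero_density :: "nat \<Rightarrow> nat \<Rightarrow> (nat \<Rightarrow> real) \<Rightarrow> (nat \<Rightarrow> real) \<Rightarrow> complex \<Rightarrow> real" where
  "zero_density n m \<alpha> \<beta> z =
    (let a = r1 n m \<alpha> \<beta> z; b = r2 n m \<alpha> \<beta> z; c = r12 n m \<alpha> \<beta> z; d = r3 n m \<alpha> \<beta> z in
     (1 / pi) * (1 / (cmod z)^2) * ((a^2 + b^2 - 2 * c^2) / (d^2 * sqrt ((a + b)^2 - 4 * c^2))))"

end

theory Submission
  imports Defs
begin

text \<open>
  The constant coefficient \<open>A\<^sub>0\<close> plays the role of the smoothing kernel of the Kac--Rice formula.
  Write \<open>H = A\<^sub>0 + F\<close>. For fixed \<open>F\<close>, the expectation over \<open>A\<^sub>0\<close> integrates the number of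
  solutions of \<open>F z = - y\<close> against the density \<open>\<rho>\<close> of \<open>A\<^sub>0\<close>; by the area formula (Sard's theorem and
  local injectivity off the critical set) this is the integral of \<open>\<rho> (F z)\<close> times the Jacobian
  \<open>| |F\<^sub>z|\<^sup>2 - |F\<^sub>w|\<^sup>2 |\<close> over \<open>T\<close>, where \<open>F\<^sub>w\<close> is the derivative in the conjugate variable.
  By Tonelli it remains to average at a fixed \<open>z \<noteq> 0\<close>. Adding the coefficients one at a time and
  completing squares turns the average into an integral over two complex variables of a Gaussian
  times \<open>| |w|\<^sup>2 - |u|\<^sup>2 |\<close>. A hyperbolic rotation preserves \<open>|w|\<^sup>2 - |u|\<^sup>2\<close> and Lebesgue measure and
  diagonalises the Gaussian exponent; polar coordinates give the closed form.
\<close>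

subsection \<open>Integrals over the complex plane\<close>

text \<open>Write W = z * F_z and U = cnj z * F_w. These are sums of the same terms as H, weighted
  by the degree j; this is the origin of s_k, t_k and the factor 1/|z|^2. Given H(z) = 0, the pair
  (W, U) is Gaussian with variances r_1/r_3 and r_2/r_3 and covariance -r_12/r_3, and H(z) has
  density 1/(pi r_3) at 0. The stated integrand is this density times the conditional mean of ||W|^2
  - |U|^2|, divided by |z|^2. Conditional expectations never occur formally: conditioning appears as
  completing squares in explicit densities. A unitary diagonalisation would destroy the indefinite
  form under the absolute value, hence the hyperbolic rotation. All integrals take values in
  [0, \<infinity>], so neither integrability nor finiteness of the zero set has to be shown. The
  price is measurability of the zero count, which rests on a separate compactness argument.\<close>

lemma nn_integral_lborel_affine:
  fixes f :: "'a::euclidean_space \<Rightarrow> ennreal"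
  assumes [measurable]: "f \<in> borel_measurable borel" and c: "c \<noteq> 0"
  shows "(\<integral>\<^sup>+x. f x \<partial>lborel) = ennreal (\<bar>c\<bar> ^ DIM('a)) * (\<integral>\<^sup>+x. f (t + c *\<^sub>R x) \<partial>lborel)"
  by (subst lborel_affine[OF c, of t])
     (simp add: nn_integral_density nn_integral_distr nn_integral_cmult)

lemma borel_measurable_cnj [measurable]: "cnj \<in> borel_measurable borel"
  by (intro borel_measurable_continuous_onI continuous_intros)

text \<open>The squared modulus carries area to pi times length on the half-line, which is all that
  a radial integrand needs from polar coordinates. The sign is there because
  \<open>measure_eqI_lessThan\<close> compares measures on upper half-lines and wants them finite:
  for the negated square these correspond to discs, for the square itself to complements of
  discs.\<close>

lemma distr_neg_cmod_square:
  "distr lborel borel (\<lambda>w::complex. - ((cmod w)\<^sup>2)) = density lborel (\<lambda>t. ennreal pi * indicator {..0} t)"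
proof (rule measure_eqI_lessThan)
  have *: "emeasure (distr lborel borel (\<lambda>w::complex. - ((cmod w)\<^sup>2))) {x<..} = ennreal (pi * max 0 (- x))" for x
  proof -
    have "emeasure (distr lborel borel (\<lambda>w::complex. - ((cmod w)\<^sup>2))) {x<..}
        = emeasure lborel (ball (0::complex) (sqrt (max 0 (- x))))"
    proof (subst emeasure_distr)
      have "(cmod w)\<^sup>2 < - x \<longleftrightarrow> cmod w < sqrt (max 0 (- x))" for w
      proof (cases "x < 0")
        case True
        have "cmod w < sqrt (- x) \<longleftrightarrow> sqrt ((cmod w)\<^sup>2) < sqrt (- x)" by simp
        also have "\<dots> \<longleftrightarrow> (cmod w)\<^sup>2 < - x" by (simp only: real_sqrt_less_iff)
        finally show ?thesis using True by (simp add: max_def)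
      next
        case False
        then show ?thesis
          by (auto simp: max_def not_less intro: order_trans[of _ 0])
      qed
      moreover have "x < - y \<longleftrightarrow> y < - x" for y :: real by linarith
      ultimately have "{w. x < - ((cmod w)\<^sup>2)} = ball (0::complex) (sqrt (max 0 (- x)))"
        by auto
      then show "emeasure lborel ((\<lambda>w::complex. - ((cmod w)\<^sup>2)) -` {x<..} \<inter> space lborel)
          = emeasure lborel (ball (0::complex) (sqrt (max 0 (- x))))"
        by (simp add: vimage_def)
    qed auto
    also have "\<dots> = ennreal (pi * max 0 (- x))"
      by (subst emeasure_ball) (auto simp: unit_ball_vol_2)
    finally show ?thesis .
  qed
  show "emeasure (distr lborel borel (\<lambda>w::complex. - ((cmod w)\<^sup>2))) {x<..} < \<infinity>" for x
    by (simp add: *)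
  show "emeasure (distr lborel borel (\<lambda>w::complex. - ((cmod w)\<^sup>2))) {x<..} =
        emeasure (density lborel (\<lambda>t. ennreal pi * indicator {..0} t)) {x<..}" for x
  proof -
    have "(\<integral>\<^sup>+t. ennreal pi * indicator {..0} t * indicator {x<..} t \<partial>lborel)
        = (\<integral>\<^sup>+t. ennreal pi * indicator {x<..0} t \<partial>lborel)"
      by (intro nn_integral_cong) (auto split: split_indicator)
    also have "\<dots> = ennreal (pi * max 0 (- x))"
      by (cases "x \<le> 0") (simp_all add: nn_integral_cmult ennreal_mult'[symmetric])
    finally show ?thesis by (simp add: * emeasure_density)
  qed
qed auto

lemma nn_integral_cmod_square:
  assumes [measurable]: "f \<in> borel_measurable borel"
  shows "(\<integral>\<^sup>+w. f ((cmod w)\<^sup>2) \<partial>lborel) = ennreal pi * (\<integral>\<^sup>+t. f t * indicator {0..} t \<partial>lborel)"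
proof -
  have "(\<integral>\<^sup>+w. f ((cmod w)\<^sup>2) \<partial>lborel)
      = (\<integral>\<^sup>+t. f (- t) \<partial>distr lborel borel (\<lambda>w::complex. - ((cmod w)\<^sup>2)))"
    by (simp add: nn_integral_distr)
  also have "\<dots> = ennreal pi * (\<integral>\<^sup>+t. f (- t) * indicator {..0} t \<partial>lborel)"
    by (simp add: distr_neg_cmod_square nn_integral_density nn_integral_cmult[symmetric] ac_simps)
  also have "(\<integral>\<^sup>+t. f (- t) * indicator {..0} t \<partial>lborel) = (\<integral>\<^sup>+t. f t * indicator {0..} t \<partial>lborel)"
    by (subst nn_integral_real_affine[where c = "-1" and t = 0])
       (auto intro!: nn_integral_cong split: split_indicator)
  finally show ?thesis .
qed

lemma nn_integral_exp_Ici: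
  assumes "p > 0"
  shows "(\<integral>\<^sup>+t. ennreal (exp (- p * t)) * indicator {0..} t \<partial>lborel) = ennreal (1 / p)"
proof -
  have "((\<lambda>x. - exp (- p * x) / p) \<longlongrightarrow> - 0 / p) at_top"
    using assms by (intro tendsto_intros filterlim_compose[OF exp_at_bot]
        filterlim_tendsto_neg_mult_at_bot[OF tendsto_const _ filterlim_ident]) auto
  then show ?thesis
    using assms
    by (subst nn_integral_FTC_atLeast[where F = "\<lambda>x. - exp (- p * x) / p" and T = 0])
       (auto intro!: derivative_eq_intros)
qed

lemma nn_integral_times_exp_Ici:
  assumes p: "p > 0"
  shows "(\<integral>\<^sup>+t. ennreal (t * exp (- p * t)) * indicator {0..} t \<partial>lborel) = ennreal (1 / p\<^sup>2)"
proof -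
  have "(\<integral>\<^sup>+t. ennreal (t * exp (- t)) * indicator {0..} t \<partial>lborel) = 1"
    using nn_intergal_power_times_exp_Ici[of 1] by simp
  \<comment> \<open>Substitution t -> p * t in the Gamma integral: one factor p comes from the
    measure, the other from the factor t.\<close>
  also have "(\<integral>\<^sup>+t. ennreal (t * exp (- t)) * indicator {0..} t \<partial>lborel)
     = ennreal p * (\<integral>\<^sup>+t. ennreal (p * t * exp (- (p * t))) * indicator {0..} (p * t) \<partial>lborel)"
    using p by (subst nn_integral_real_affine[where c = p and t = 0]) auto
  also have "\<dots> = ennreal p * (\<integral>\<^sup>+t. ennreal p * (ennreal (t * exp (- p * t)) * indicator {0..} t) \<partial>lborel)"
  proof (rule arg_cong[where f = "(*) (ennreal p)"], rule nn_integral_cong)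
    fix t
    show "ennreal (p * t * exp (- (p * t))) * indicator {0..} (p * t)
        = ennreal p * (ennreal (t * exp (- p * t)) * indicator {0..} t)"
      using p by (cases "t \<ge> 0") (auto simp: ennreal_mult'[symmetric] zero_le_mult_iff mult.assoc)
  qed
  also have "\<dots> = ennreal (p\<^sup>2) * (\<integral>\<^sup>+t. ennreal (t * exp (- p * t)) * indicator {0..} t \<partial>lborel)"
    using p by (subst nn_integral_cmult) (auto simp: ennreal_mult' power2_eq_square ac_simps)
  finally have *: "1 = ennreal (p\<^sup>2) * (\<integral>\<^sup>+t. ennreal (t * exp (- p * t)) * indicator {0..} t \<partial>lborel)" ..
  have "ennreal (1 / p\<^sup>2) = ennreal (1 / p\<^sup>2) * 
     (ennreal (p\<^sup>2) * (\<integral>\<^sup>+t. ennreal (t * exp (- p * t)) * indicator {0..} t \<partial>lborel))"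
    using * by (metis mult.right_neutral)
  also have "\<dots> = ennreal (1 / p\<^sup>2 * p\<^sup>2) * (\<integral>\<^sup>+t. ennreal (t * exp (- p * t)) * indicator {0..} t \<partial>lborel)"
    by (subst ennreal_mult') (auto simp: mult.assoc)
  finally show ?thesis using p by simp
qed

subsection \<open>Complex Gaussian densities\<close>

text \<open>The density inside \<open>complex_gaussian\<close>; \<open>v\<close> is the mean of the
  squared modulus, so each real coordinate has variance v/2.\<close>

definition cgauss :: "real \<Rightarrow> complex \<Rightarrow> real" where
  "cgauss v z = exp (- ((cmod z)\<^sup>2) / v) / (pi * v)"

lemma cgauss_measurable [measurable]: "cgauss v \<in> borel_measurable borel"
  unfolding cgauss_def by measurable

lemma cgauss_nonneg [simp]: "v > 0 \<Longrightarrow> cgauss v z \<ge> 0"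
  by (simp add: cgauss_def)

lemma cgauss_uminus [simp]: "cgauss v (- z) = cgauss v z"
  by (simp add: cgauss_def)

lemma nn_integral_cgauss:
  assumes v: "v > 0"
  shows "(\<integral>\<^sup>+w. ennreal (cgauss v w) \<partial>lborel) = 1"
proof -
  have "(\<integral>\<^sup>+w. ennreal (cgauss v w) \<partial>lborel)
      = ennreal (1 / (pi * v)) * (\<integral>\<^sup>+w. ennreal (exp (- (1 / v) * (cmod w)\<^sup>2)) \<partial>lborel)"
    using v by (subst nn_integral_cmult[symmetric])
      (auto simp: cgauss_def ennreal_mult'[symmetric] intro!: nn_integral_cong)
  also have "(\<integral>\<^sup>+w. ennreal (exp (- (1 / v) * (cmod w)\<^sup>2)) \<partial>lborel) = ennreal pi * ennreal (1 / (1 / v))"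
    using v by (subst nn_integral_cmod_square[where f = "\<lambda>t. ennreal (exp (- (1 / v) * t))"], simp, subst nn_integral_exp_Ici) auto
  finally show ?thesis using v by (simp add: ennreal_mult'[symmetric])
qed

text \<open>Bayes' rule for w = k * \<zeta> + noise, with variance \<open>a\<close> for \<zeta> and
  \<open>S\<close> for the noise. The joint density is the marginal density of w times the
  conditional density of \<zeta>, which has mean k * a / D times w and variance S * a / D, where D =
  S + k^2 * a.\<close>

lemma cgauss_mult:
  fixes k :: real
  assumes S: "S > 0" and a: "a > 0"
  shows "cgauss S (w - of_real k * \<zeta>) * cgauss a \<zeta> =
    cgauss (S + k\<^sup>2 * a) w * cgauss (S * a / (S + k\<^sup>2 * a)) (\<zeta> - of_real (k * a / (S + k\<^sup>2 * a)) * w)"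
proof -
  define D where "D = S + k\<^sup>2 * a"
  have D: "D > 0" using S a by (simp add: D_def add_pos_nonneg)
  \<comment> \<open>As k is real, real and imaginary parts do not mix: the square is completed in
    one real coordinate and the identity is added up over both.\<close>
  have real_id: "(x - k * y)\<^sup>2 / S + y\<^sup>2 / a = x\<^sup>2 / D + (y - k * a / D * x)\<^sup>2 / (S * a / D)" for x y :: real
  proof -
    have "((x - k * y)\<^sup>2 / S + y\<^sup>2 / a) * (S * a * D) = ((x - k * y)\<^sup>2 * a + y\<^sup>2 * S) * D"
      using S a D by (simp add: field_simps)
    also have "\<dots> = x\<^sup>2 * S * a + (D * y - k * a * x)\<^sup>2"
      unfolding D_def by algebra
    also have "\<dots> = (x\<^sup>2 / D + (y - k * a / D * x)\<^sup>2 / (S * a / D)) * (S * a * D)"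
      using S a D by (simp add: field_simps power2_eq_square)
    finally show ?thesis using S a D by simp
  qed
  have "(cmod (w - of_real k * \<zeta>))\<^sup>2 / S + (cmod \<zeta>)\<^sup>2 / a =
     ((Re w - k * Re \<zeta>)\<^sup>2 / S + (Re \<zeta>)\<^sup>2 / a) + ((Im w - k * Im \<zeta>)\<^sup>2 / S + (Im \<zeta>)\<^sup>2 / a)"
    by (simp add: cmod_power2 add_divide_distrib)
  also have "\<dots> = (cmod w)\<^sup>2 / D + (cmod (\<zeta> - of_real (k * a / D) * w))\<^sup>2 / (S * a / D)"
    unfolding real_id by (simp add: cmod_power2 add_divide_distrib distrib_right)
  finally have eq: "(cmod (w - of_real k * \<zeta>))\<^sup>2 / S + (cmod \<zeta>)\<^sup>2 / a =
     (cmod w)\<^sup>2 / D + (cmod (\<zeta> - of_real (k * a / D) * w))\<^sup>2 / (S * a / D)" .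
  have "exp (- ((cmod (w - of_real k * \<zeta>))\<^sup>2) / S) * exp (- ((cmod \<zeta>)\<^sup>2) / a) =
     exp (- ((cmod w)\<^sup>2) / D) * exp (- ((cmod (\<zeta> - of_real (k * a / D) * w))\<^sup>2) / (S * a / D))"
    by (simp only: exp_add[symmetric] minus_divide_left[symmetric] minus_add_distrib[symmetric] eq)
  moreover have "pi * S * (pi * a) = pi * D * (pi * (S * a / D))"
    using D by simp
  ultimately show ?thesis
    unfolding cgauss_def D_def[symmetric] times_divide_times_eq by (simp only:)
qed

lemma nn_integral_cgauss_shift:
  "v > 0 \<Longrightarrow> (\<integral>\<^sup>+\<zeta>. ennreal (cgauss v (\<zeta> - \<mu>)) \<partial>lborel) = 1"
  using nn_integral_lborel_affine[of "\<lambda>\<zeta>. ennreal (cgauss v (\<zeta> - \<mu>))" 1 \<mu>] nn_integral_cgauss[of v]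
  by simp

text \<open>This is \<open>cgauss_mult\<close> with -k after centring \<zeta>; the conditional
  factor integrates to 1. The real k may have any sign or vanish, which matters because it will be 1
  - k * \<kappa>.\<close>

lemma nn_integral_cgauss_convolution:
  fixes k :: real
  assumes V: "V > 0" and \<tau>: "\<tau> > 0"
  shows "(\<integral>\<^sup>+\<zeta>. ennreal (cgauss V (m + of_real k * \<zeta>) * cgauss \<tau> (\<zeta> - \<mu>)) \<partial>lborel)
     = ennreal (cgauss (V + k\<^sup>2 * \<tau>) (m + of_real k * \<mu>))"
proof -
  define D where "D = V + k\<^sup>2 * \<tau>"
  have D: "D > 0" using V \<tau> by (simp add: D_def add_pos_nonneg)
  have "(\<integral>\<^sup>+\<zeta>. ennreal (cgauss V (m + of_real k * \<zeta>) * cgauss \<tau> (\<zeta> - \<mu>)) \<partial>lborel)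
     = (\<integral>\<^sup>+\<zeta>. ennreal (cgauss V ((m + of_real k * \<mu>) - of_real (- k) * \<zeta>) * cgauss \<tau> \<zeta>) \<partial>lborel)"
    by (subst nn_integral_lborel_affine[where c = 1 and t = \<mu>]) (auto simp: algebra_simps)
  also have "\<dots> = (\<integral>\<^sup>+\<zeta>. ennreal (cgauss D (m + of_real k * \<mu>)) *
      ennreal (cgauss (V * \<tau> / D) (\<zeta> - of_real (- k * \<tau> / D) * (m + of_real k * \<mu>))) \<partial>lborel)"
    using cgauss_mult[OF V \<tau>, of "m + of_real k * \<mu>" "- k"] D
    by (simp add: D_def ennreal_mult'[symmetric] del: of_real_minus of_real_divide)
  also have "\<dots> = ennreal (cgauss D (m + of_real k * \<mu>))"
    using V \<tau> D by (simp add: nn_integral_cmult nn_integral_cgauss_shift del: of_real_minus of_real_divide)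
  finally show ?thesis by (simp add: D_def)
qed

subsection \<open>The area formula\<close>

text \<open>\<open>has_absolute_integral_change_of_variables\<close> makes integrability of the
  Jacobian equivalent to finite measure of the image. Equal values in the finite case and
  simultaneous infinity otherwise give one identity in [0, \<infinity>].\<close>

lemma emeasure_injective_image:
  fixes f :: "real^'n::{finite,wellorder} \<Rightarrow> real^'n::_"
  assumes A: "A \<in> sets lebesgue"
    and der: "\<And>x. x \<in> A \<Longrightarrow> (f has_derivative f' x) (at x within A)"
    and inj: "inj_on f A"
  shows "emeasure lebesgue (f ` A) =
    (\<integral>\<^sup>+x. ennreal \<bar>det (matrix (f' x))\<bar> * indicator A x \<partial>lebesgue)"
proof -
  let ?D = "\<lambda>x. \<bar>det (matrix (f' x))\<bar>"
  have fA: "f ` A \<in> sets lebesgue"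
    using der by (intro differentiable_image_in_sets_lebesgue A)
      (auto simp: differentiable_on_def differentiable_def)
  have meas: "(\<lambda>x. indicator A x *\<^sub>R ?D x) \<in> borel_measurable lebesgue"
  proof -
    have "?D \<in> borel_measurable (lebesgue_on A)"
      using borel_measurable_det_Jacobian[OF A der] by measurable
    then show ?thesis
      using A by (simp add: borel_measurable_restrict_space_iff)
  qed
  \<comment> \<open>The integrand is the constant 1, wrapped as a vector in \<open>real^1\<close> to
    fit the vector-valued change of variables.\<close>
  have cov: "?D absolutely_integrable_on A \<and> integral A ?D = b \<longleftrightarrow>
      (\<lambda>_. 1::real) absolutely_integrable_on f ` A \<and> integral (f ` A) (\<lambda>_. 1) = b" for b
    using has_absolute_integral_change_of_variables[OF A der inj, of "\<lambda>_. vec 1 :: real^1" "vec b"]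
    by (simp add: absolutely_integrable_on_1_iff integral_on_1_eq)
  have lm: "(\<lambda>_. 1::real) absolutely_integrable_on f ` A \<longleftrightarrow> f ` A \<in> lmeasurable"
    using lmeasurable_iff_integrable_on
    by (auto simp: absolutely_integrable_on_def)
  have nn: "(\<integral>\<^sup>+x. ennreal (?D x) * indicator A x \<partial>lebesgue) = (\<integral>\<^sup>+x. ennreal (indicator A x *\<^sub>R ?D x) \<partial>lebesgue)"
    by (intro nn_integral_cong) (auto split: split_indicator)
  show ?thesis
  proof (cases "f ` A \<in> lmeasurable")
    case True
    then have ai: "?D absolutely_integrable_on A" and eq: "integral A ?D = measure lebesgue (f ` A)"
      using cov[of "integral (f ` A) (\<lambda>_. 1)"] lm lmeasure_integral[OF True] by auto
    have "(\<integral>\<^sup>+x. ennreal (indicator A x *\<^sub>R ?D x) \<partial>lebesgue) = ennreal (\<integral>x. indicator A x *\<^sub>R ?D x \<partial>lebesgue)"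
      using ai by (intro nn_integral_eq_integral) (auto simp: set_integrable_def)
    also have "(\<integral>x. indicator A x *\<^sub>R ?D x \<partial>lebesgue) = integral A ?D"
      using set_lebesgue_integral_eq_integral(2)[OF ai] by (simp add: set_lebesgue_integral_def)
    also have "ennreal (integral A ?D) = emeasure lebesgue (f ` A)"
      using True by (simp add: eq emeasure_eq_measure2)
    finally show ?thesis by (simp add: nn)
  next
    case False
    have "\<not> ?D absolutely_integrable_on A"
      using cov lm False by blast
    then have "(\<integral>\<^sup>+x. ennreal (indicator A x *\<^sub>R ?D x) \<partial>lebesgue) = \<infinity>"
      using meas unfolding set_integrable_def
      by (auto simp: integrable_iff_bounded less_top[symmetric] abs_mult)
    moreover have "emeasure lebesgue (f ` A) = \<infinity>"
      using False fA by (auto simp: fmeasurable_def less_top[symmetric])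
    ultimately show ?thesis by (simp add: nn)
  qed
qed

text \<open>The passage from sets to integrands is an equality of two measures: the push-forward of
  Jacobian-weighted Lebesgue measure on \<open>E\<close>, and Lebesgue measure restricted to the
  image. The image is only known to be Lebesgue measurable, so one side lives on the
  completion.\<close>

lemma nn_integral_injective_image:
  fixes f :: "real^'n::{finite,wellorder} \<Rightarrow> real^'n::_"
  assumes E: "E \<in> sets borel"
    and der: "\<And>x. (f has_derivative f' x) (at x)"
    and D [measurable]: "(\<lambda>x. det (matrix (f' x))) \<in> borel_measurable borel"
    and inj: "inj_on f E"
    and g [measurable]: "g \<in> borel_measurable borel"
  shows "(\<integral>\<^sup>+c. indicator (f ` E) c * g c \<partial>lebesgue) =
    (\<integral>\<^sup>+x. g (f x) * ennreal \<bar>det (matrix (f' x))\<bar> * indicator E x \<partial>lborel)"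
proof -
  have f [measurable]: "f \<in> borel_measurable borel"
    using der by (intro borel_measurable_continuous_onI continuous_at_imp_continuous_on ballI)
      (auto intro: has_derivative_continuous)
  note E [measurable]
  let ?D = "\<lambda>x. ennreal \<bar>det (matrix (f' x))\<bar>"
  have fE: "f ` E \<in> sets lebesgue"
    using der E by (intro differentiable_image_in_sets_lebesgue)
      (auto simp: differentiable_on_def differentiable_def intro: has_derivative_at_withinI)
  then have [measurable]: "indicator (f ` E) \<in> borel_measurable lebesgue"
    by simp
  have id: "(\<lambda>x. x) \<in> measurable lebesgue borel"
    by (intro measurable_completion) simp
  have g': "g \<in> borel_measurable lebesgue"
    by (intro measurable_completion) simp
  define N1 where "N1 = distr (density lborel (\<lambda>x. ?D x * indicator E x)) borel f"
  define N2 where "N2 = distr (density lebesgue (indicator (f ` E))) borel (\<lambda>x. x)"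
  have "N1 = N2"
  proof (rule measure_eqI)
    fix B assume "B \<in> sets N1"
    then have B [measurable]: "B \<in> sets borel" by (simp add: N1_def)
    have EB [measurable]: "E \<inter> f -` B \<in> sets borel"
      using measurable_sets[OF f B] by (simp add: sets.Int)
    have "emeasure N1 B = (\<integral>\<^sup>+x. ?D x * indicator (E \<inter> f -` B) x \<partial>lborel)"
      unfolding N1_def using measurable_sets[OF f B]
      by (subst emeasure_distr) (auto simp: emeasure_density intro!: nn_integral_cong split: split_indicator)
    also have "\<dots> = emeasure lebesgue (f ` (E \<inter> f -` B))"
      using EB by (subst emeasure_injective_image[where f' = f'])
        (auto simp: nn_integral_completion intro: has_derivative_at_withinI[OF der] inj_on_subset[OF inj])
    also have "f ` (E \<inter> f -` B) = f ` E \<inter> B" by auto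
    also have "emeasure lebesgue (f ` E \<inter> B) = (\<integral>\<^sup>+x. indicator (f ` E) x * indicator B x \<partial>lebesgue)"
      using fE B by (simp add: indicator_inter_arith[symmetric] del: nn_integral_indicator)
         (subst nn_integral_indicator, auto)
    also have "\<dots> = emeasure N2 B"
      unfolding N2_def using id B
      by (subst emeasure_distr) (auto simp: emeasure_density)
    finally show "emeasure N1 B = emeasure N2 B" .
  qed (simp add: N1_def N2_def)
  moreover have "(\<integral>\<^sup>+c. g c \<partial>N1) = (\<integral>\<^sup>+x. g (f x) * ?D x * indicator E x \<partial>lborel)"
    unfolding N1_def by (subst nn_integral_distr) (auto simp: nn_integral_density ac_simps)
  moreover have "(\<integral>\<^sup>+c. g c \<partial>N2) = (\<integral>\<^sup>+c. indicator (f ` E) c * g c \<partial>lebesgue)"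
    unfolding N2_def using id g' by (subst nn_integral_distr) (auto simp: nn_integral_density)
  ultimately show ?thesis by simp
qed

text \<open>The injectivity half of the inverse function theorem.
  \<open>has_derivative_locally_injective\<close> asks for a left inverse of the derivative at
  \<open>a\<close> and for continuity of the derivative in operator norm; the latter is read off
  from the matrix entries.\<close>

lemma locally_injective_matrix:
  fixes f :: "real^'n::{finite,wellorder} \<Rightarrow> real^'n::_"
  assumes der: "\<And>x. (f has_derivative f' x) (at x)"
    and cont: "continuous_on UNIV (\<lambda>x. matrix (f' x))"
    and nz: "det (matrix (f' a)) \<noteq> 0"
  obtains r where "r > 0" "inj_on f (ball a r)"
proof -
  have lin: "linear (f' x)" for x
    using der[of x] by (rule has_derivative_linear)
  have f': "f' x = (*v) (matrix (f' x))" for x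
    using lin[of x] by (simp add: matrix_vector_mul)
  obtain g' where g': "linear g'" "g' \<circ> f' a = id"
    using linear_injective_left_inverse[OF lin[of a]] det_nz_iff_inj[OF lin[of a]] nz by auto
  have small: "\<exists>d>0. \<forall>x. dist a x < d \<longrightarrow> onorm (\<lambda>v. f' x v - f' a v) < e" if e: "e > 0" for e
  proof -
    \<comment> \<open>The operator norm of an n by n matrix is at most n^2 times a bound for its
      entries. The additional factor 1/2 below makes the final inequality strict.\<close>
    define N where "N = real CARD('n) * real CARD('n)"
    have N: "N > 0" by (simp add: N_def)
    have "continuous (at a) (\<lambda>x. matrix (f' x))"
      using cont by (simp add: continuous_on_eq_continuous_at)
    then obtain d where d: "d > 0" "\<And>x. dist x a < d \<Longrightarrow> dist (matrix (f' x)) (matrix (f' a)) < e / (2 * N)"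
      using e N unfolding continuous_at_eps_delta by (metis divide_pos_pos mult_pos_pos zero_less_numeral)
    have "onorm (\<lambda>v. f' x v - f' a v) < e" if x: "dist a x < d" for x
    proof -
      have "onorm ((*v) (matrix (f' x) - matrix (f' a))) \<le> real CARD('n) * real CARD('n) * (e / (2 * N))"
      proof (rule onorm_le_matrix_component)
        fix i j
        have "\<bar>(matrix (f' x) - matrix (f' a)) $ i $ j\<bar> \<le> norm ((matrix (f' x) - matrix (f' a)) $ i)"
          by (rule component_le_norm_cart)
        also have "\<dots> \<le> norm (matrix (f' x) - matrix (f' a))"
          by (rule Finite_Cartesian_Product.norm_nth_le)
        also have "\<dots> \<le> e / (2 * N)"
          using d(2)[of x] x by (simp add: dist_norm norm_minus_commute)
        finally show "\<bar>(matrix (f' x) - matrix (f' a)) $ i $ j\<bar> \<le> e / (2 * N)" .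
      qed
      also have "\<dots> < e" using e N by (simp add: N_def)
      also have "(*v) (matrix (f' x) - matrix (f' a)) = (\<lambda>v. f' x v - f' a v)"
        using f' by (metis matrix_vector_mult_diff_rdistrib)
      finally show ?thesis .
    qed
    with d(1) show ?thesis by blast
  qed
  show ?thesis
    using has_derivative_locally_injective[of a UNIV g' f' f, OF _ _ _ g'(2) der small] g'(1)
      linear_conv_bounded_linear that by auto
qed

text \<open>Critical values are null by Sard and critical points contribute no Jacobian, so both
  sides see only the open set \<open>S\<close> of regular points. There the map is injective on
  countably many disjoint Borel pieces, and the number of regular preimages of c is the number of
  pieces whose image contains c. Counting measure covers infinitely many preimages as well.\<close>

theorem area_formula:
  fixes f :: "real^'n::{finite,wellorder} \<Rightarrow> real^'n::_"
  assumes der: "\<And>x. (f has_derivative f' x) (at x)"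
    and cont: "continuous_on UNIV (\<lambda>x. matrix (f' x))"
    and T: "T \<in> sets borel"
    and g [measurable]: "g \<in> borel_measurable borel"
  shows "(\<integral>\<^sup>+c. emeasure (count_space UNIV) {x\<in>T. f x = c} * g c \<partial>lborel) =
    (\<integral>\<^sup>+x\<in>T. g (f x) * ennreal \<bar>det (matrix (f' x))\<bar> \<partial>lborel)"
proof -
  let ?D = "\<lambda>x. det (matrix (f' x))"
  note T [measurable]
  have contD: "continuous_on UNIV ?D"
    using cont unfolding det_def by (intro continuous_intros) (auto intro!: continuous_intros)
  then have D [measurable]: "?D \<in> borel_measurable borel"
    by (rule borel_measurable_continuous_onI)
  have f [measurable]: "f \<in> borel_measurable borel"
    using der by (intro borel_measurable_continuous_onI continuous_at_imp_continuous_on ballI)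
      (auto intro: has_derivative_continuous)
  have g' [measurable]: "g \<in> borel_measurable lebesgue"
    by (intro measurable_completion) simp
  define S where "S = {x. ?D x \<noteq> 0}"
  have oS: "open S"
    unfolding S_def using contD by (intro open_Collect_neq continuous_on_const) auto
  define F where "F = {U. open U \<and> U \<subseteq> S \<and> inj_on f U}"
  have "\<exists>U\<in>F. x \<in> U" if "x \<in> S" for x
  proof -
    obtain r where r: "r > 0" "inj_on f (ball x r)"
      using locally_injective_matrix[OF der cont, of x] \<open>x \<in> S\<close> by (auto simp: S_def)
    then have "ball x r \<inter> S \<in> F"
      using oS by (auto simp: F_def intro: inj_on_subset)
    then show ?thesis using r \<open>x \<in> S\<close> by (intro bexI[of _ "ball x r \<inter> S"]) auto
  qed
  then have UF: "\<Union>F = S" by (auto simp: F_def)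
  obtain F' where F': "F' \<subseteq> F" "countable F'" "\<Union>F' = \<Union>F"
    using Lindelof[of F] by (auto simp: F_def)
  \<comment> \<open>The empty set is added so that there is something to enumerate even if the
    subcover is empty.\<close>
  define U where "U = from_nat_into (insert {} F')"
  have rU: "range U = insert {} F'"
    unfolding U_def using F'(2) by (intro range_from_nat_into) auto
  then have U: "open (U n)" "inj_on f (U n)" for n
    using F'(1) rangeI[of U n] by (auto simp: F_def)
  have UU: "(\<Union>n. U n) = S" using rU F' UF by auto
  define E where "E n = disjointed U n \<inter> T" for n
  have [measurable]: "E n \<in> sets borel" for n
    unfolding E_def disjointed_def using U T by (auto intro!: sets.Int sets.Diff sets.finite_UN)
  have disj: "disjoint_family E"
    using disjoint_family_disjointed[of U] by (auto simp: E_def disjoint_family_on_def)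
  have UE: "(\<Union>n. E n) = S \<inter> T"
    using UN_disjointed_eq[of U] UU by (auto simp: E_def)
  have injE: "inj_on f (E n)" for n
    using disjointed_subset[of U n] by (intro inj_on_subset[OF U(2)[of n]]) (auto simp: E_def)
  have fE: "f ` E n \<in> sets lebesgue" for n
    using der by (intro differentiable_image_in_sets_lebesgue)
      (auto simp: differentiable_on_def differentiable_def intro: has_derivative_at_withinI)
  then have [measurable]: "indicator (f ` E n) \<in> borel_measurable lebesgue" for n
    by simp
  have count: "emeasure (count_space UNIV) {x\<in>S \<inter> T. f x = c} = (\<Sum>n. indicator (f ` E n) c)" for c
  proof -
    have "{x\<in>S \<inter> T. f x = c} = (\<Union>n. {x\<in>E n. f x = c})"
      using UE by blast
    moreover have "emeasure (count_space UNIV) (\<Union>n. {x\<in>E n. f x = c}) =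
        (\<Sum>n. emeasure (count_space UNIV) {x\<in>E n. f x = c})"
      using disj by (intro suminf_emeasure[symmetric]) (auto simp: disjoint_family_on_def)
    moreover have "emeasure (count_space UNIV) {x\<in>E n. f x = c} = indicator (f ` E n) c" for n
    proof (cases "c \<in> f ` E n")
      case True
      then obtain x where "x \<in> E n" "f x = c" by auto
      then have "{x\<in>E n. f x = c} = {x}"
        using injE[of n] by (auto dest: inj_onD)
      then show ?thesis using True by simp
    next
      case False
      then have "{x\<in>E n. f x = c} = {}" by auto
      then show ?thesis using False by (metis emeasure_empty indicator_simps(2))
    qed
    ultimately show ?thesis by simp
  qed
  have "negligible (f ` (T - S))"
  proof (rule baby_Sard)
    fix x assume "x \<in> T - S"
    then have "det (matrix (f' x)) = 0" by (simp add: S_def)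
    then show "rank (matrix (f' x)) < CARD('n)"
      by (simp add: det_eq_0_rank)
    show "(f has_derivative f' x) (at x within T - S)"
      using der by (rule has_derivative_at_withinI)
  qed simp
  then have "AE c in lebesgue. c \<notin> f ` (T - S)"
    by (simp add: negligible_iff_null_sets AE_not_in)
  then have ae: "AE c in lebesgue. {x\<in>T. f x = c} = {x\<in>S \<inter> T. f x = c}"
    by eventually_elim blast
  \<comment> \<open>The images of the pieces are only known to be Lebesgue measurable, so sum and
    integral are exchanged over the completion.\<close>
  have "(\<integral>\<^sup>+c. emeasure (count_space UNIV) {x\<in>T. f x = c} * g c \<partial>lborel)
      = (\<integral>\<^sup>+c. emeasure (count_space UNIV) {x\<in>T. f x = c} * g c \<partial>lebesgue)"
    by (simp add: nn_integral_completion)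
  also have "\<dots> = (\<integral>\<^sup>+c. (\<Sum>n. indicator (f ` E n) c * g c) \<partial>lebesgue)"
    using ae by (intro nn_integral_cong_AE, eventually_elim) (simp only: count ennreal_suminf_multc)
  also have "\<dots> = (\<Sum>n. \<integral>\<^sup>+c. indicator (f ` E n) c * g c \<partial>lebesgue)"
    by (intro nn_integral_suminf) measurable
  also have "\<dots> = (\<Sum>n. \<integral>\<^sup>+x. g (f x) * ennreal \<bar>?D x\<bar> * indicator (E n) x \<partial>lborel)"
    using der injE by (intro suminf_cong nn_integral_injective_image) auto
  also have "\<dots> = (\<integral>\<^sup>+x. (\<Sum>n. g (f x) * ennreal \<bar>?D x\<bar> * indicator (E n) x) \<partial>lborel)"
    by (intro nn_integral_suminf[symmetric]) measurable
  also have "\<dots> = (\<integral>\<^sup>+x\<in>T. g (f x) * ennreal \<bar>?D x\<bar> \<partial>lborel)"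
  proof (intro nn_integral_cong)
    fix x
    have "(\<Sum>n. g (f x) * ennreal \<bar>?D x\<bar> * indicator (E n) x) = g (f x) * ennreal \<bar>?D x\<bar> * indicator (S \<inter> T) x"
      using suminf_indicator[OF disj, of x] by (simp add: UE ennreal_suminf_cmult)
    also have "\<dots> = g (f x) * ennreal \<bar>?D x\<bar> * indicator T x"
      by (auto simp: S_def split: split_indicator)
    finally show "(\<Sum>n. g (f x) * ennreal \<bar>?D x\<bar> * indicator (E n) x) = g (f x) * ennreal \<bar>?D x\<bar> * indicator T x" .
  qed
  finally show ?thesis .
qed

subsection \<open>Measurability of the number of zeros\<close>

text \<open>Replaces a condition on uncountably many points by a countable one, so that it will
  define a measurable event. On the compact closed ball the norm attains its minimum; continuity
  lets points of the dense set \<open>D\<close> in the open ball come arbitrarily close to that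
  minimum.\<close>

lemma zero_in_cball_iff:
  fixes f :: "'z::euclidean_space \<Rightarrow> 'c::real_normed_vector"
  assumes f: "continuous_on UNIV f" and r: "r > 0"
    and D: "\<And>X. open X \<Longrightarrow> X \<noteq> {} \<Longrightarrow> \<exists>d\<in>D. d \<in> X"
  shows "(\<exists>z\<in>cball a r. f z = 0) \<longleftrightarrow> (\<forall>k::nat. \<exists>z\<in>D \<inter> ball a r. norm (f z) < 1 / real (Suc k))"
    (is "?L \<longleftrightarrow> ?R")
proof
  assume ?L
  then obtain z0 where z0: "z0 \<in> cball a r" "f z0 = 0" by auto
  show ?R
  proof
    fix k :: nat
    let ?X = "{z. norm (f z) < 1 / real (Suc k)}"
    have o: "open ?X"
      using f by (intro open_Collect_less continuous_intros) auto
    \<comment> \<open>The zero may lie on the sphere. For r > 0 it is still in the closure of the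
      open ball, so each of its open neighbourhoods meets the open ball in a nonempty open set,
      which \<open>D\<close> hits.\<close>
    have "z0 \<in> closure (ball a r)" using z0 r by simp
    moreover have "z0 \<in> ?X" using z0 by simp
    ultimately have "?X \<inter> ball a r \<noteq> {}"
      using o open_Int_closure_eq_empty[OF o, of "ball a r"] by blast
    then show "\<exists>z\<in>D \<inter> ball a r. norm (f z) < 1 / real (Suc k)"
      using D[OF open_Int[OF o open_ball]] by blast
  qed
next
  assume R: ?R
  have "continuous_on (cball a r) (\<lambda>z. norm (f z))"
    using f by (intro continuous_intros) (auto intro: continuous_on_subset)
  then obtain z where z: "z \<in> cball a r" "\<And>y. y \<in> cball a r \<Longrightarrow> norm (f z) \<le> norm (f y)"
    using continuous_attains_inf[of "cball a r" "\<lambda>z. norm (f z)"] r by auto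
  have "norm (f z) < 1 / real (Suc k)" for k
    using R z(2) by (metis IntD2 ball_subset_cball in_mono order_le_less_trans)
  then have "\<not> norm (f z) > 0"
    using nat_approx_posE by (metis less_asym)
  then show ?L using z(1) by auto
qed

lemma finite_separation:
  fixes T :: "'z::metric_space set"
  assumes "finite Y" "Y \<subseteq> T" "open T"
  obtains e where "e > 0" "\<And>x. x \<in> Y \<Longrightarrow> cball x e \<subseteq> T"
    "\<And>x y. x \<in> Y \<Longrightarrow> y \<in> Y \<Longrightarrow> x \<noteq> y \<Longrightarrow> e \<le> dist x y"
proof -
  have "\<exists>e>0. cball x e \<subseteq> T \<and> (\<forall>y\<in>Y. x \<noteq> y \<longrightarrow> e \<le> dist x y)" if "x \<in> Y" for x
  proof -
    obtain e where "e > 0" "cball x e \<subseteq> T"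
      using assms \<open>x \<in> Y\<close> open_contains_cball by blast
    moreover obtain d where "d > 0" "\<And>y. y \<in> Y \<Longrightarrow> y \<noteq> x \<Longrightarrow> d \<le> dist x y"
      using finite_set_avoid[OF assms(1)] by metis
    ultimately show ?thesis
      by (intro exI[of _ "min e d"]) (fastforce simp: subset_iff)
  qed
  then obtain e where e: "\<And>x. x \<in> Y \<Longrightarrow> e x > 0" "\<And>x. x \<in> Y \<Longrightarrow> cball x (e x) \<subseteq> T"
    "\<And>x y. x \<in> Y \<Longrightarrow> y \<in> Y \<Longrightarrow> x \<noteq> y \<Longrightarrow> e x \<le> dist x y"
    by metis
  \<comment> \<open>Inserting 1 gives the minimum a value when \<open>Y\<close> is empty.\<close>
  define m where "m = Min (insert 1 (e ` Y))"
  have m: "m \<le> e x" if "x \<in> Y" for x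
    using assms that by (auto simp: m_def)
  show ?thesis
  proof (rule that[of m])
    show "m > 0" using assms e by (auto simp: m_def)
    show "cball x m \<subseteq> T" if "x \<in> Y" for x
      using e(2)[OF that] m[OF that] by (auto simp: subset_iff)
    show "m \<le> dist x y" if "x \<in> Y" "y \<in> Y" "x \<noteq> y" for x y
      using e(3)[OF that] m[OF that(1)] by simp
  qed
qed

text \<open>The count is a supremum of countably many measurable functions: over finite disjoint
  families of closed balls inside \<open>T\<close>, the number of balls that contain a zero.
  Disjoint balls contain distinct zeros, and any finite set of zeros is separated by such a
  family.\<close>

lemma borel_measurable_count_zeros:
  fixes h :: "'w \<Rightarrow> 'z::euclidean_space \<Rightarrow> 'c::{real_normed_vector, second_countable_topology}"
  assumes cont: "\<And>\<omega>. \<omega> \<in> space M \<Longrightarrow> continuous_on UNIV (h \<omega>)"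
    and meas [measurable]: "\<And>z. (\<lambda>\<omega>. h \<omega> z) \<in> borel_measurable M"
    and T: "open T"
  shows "(\<lambda>\<omega>. emeasure (count_space UNIV) {z\<in>T. h \<omega> z = 0}) \<in> borel_measurable M"
proof -
  obtain D :: "'z set" where D: "countable D" "\<And>X. open X \<Longrightarrow> X \<noteq> {} \<Longrightarrow> \<exists>d\<in>D. d \<in> X"
    using countable_dense_exists by blast
  \<comment> \<open>Centres in a countable dense set and radii 1/(n+1) keep the collection
    countable, hence also its finite subfamilies.\<close>
  define \<K> where "\<K> = {K. \<exists>a\<in>D. \<exists>n::nat. K = cball a (1 / real (Suc n)) \<and> K \<subseteq> T}"
  have "\<K> \<subseteq> (\<lambda>(a, n::nat). cball a (1 / real (Suc n))) ` (D \<times> UNIV)"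
    by (auto simp: \<K>_def)
  then have cK: "countable \<K>"
    using D(1) by (meson countable_SIGMA countable_image countable_subset countableI_type)
  define hit where "hit K \<omega> \<longleftrightarrow> (\<exists>z\<in>K. h \<omega> z = 0)" for K \<omega>
  define \<C> where "\<C> = {C. finite C \<and> C \<subseteq> \<K> \<and> disjoint C}"
  have "\<C> \<subseteq> {C. finite C \<and> C \<subseteq> \<K>}" by (auto simp: \<C>_def)
  then have cC: "countable \<C>"
    using countable_Collect_finite_subset[OF cK] by (meson countable_subset)
  have hitm: "{\<omega>\<in>space M. hit K \<omega>} \<in> sets M" if K: "K \<in> \<K>" for K
  proof -
    obtain a n where K: "K = cball a (1 / real (Suc n))" using K by (auto simp: \<K>_def)
    have "{\<omega>\<in>space M. hit K \<omega>} =
       {\<omega>\<in>space M. \<forall>k::nat. \<exists>z\<in>D \<inter> ball a (1 / real (Suc n)). norm (h \<omega> z) < 1 / real (Suc k)}"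
      using zero_in_cball_iff[OF cont _ D(2), of _ "1 / real (Suc n)" a] by (auto simp: hit_def K)
    also have "\<dots> \<in> sets M"
      using D(1) by (intro sets.sets_Collect_countable_All sets.sets_Collect_countable_Bex) auto
    finally show ?thesis .
  qed
  have eq: "emeasure (count_space UNIV) {z\<in>T. h \<omega> z = 0} =
      (SUP C\<in>\<C>. \<Sum>K\<in>C. indicator {\<omega>\<in>space M. hit K \<omega>} \<omega>)" (is "?c = ?s") if \<omega>: "\<omega> \<in> space M" for \<omega>
  proof (rule antisym)
    let ?Z = "{z\<in>T. h \<omega> z = 0}"
    show "?s \<le> ?c"
    proof (rule SUP_least)
      fix C assume C: "C \<in> \<C>"
      define C' where "C' = {K\<in>C. hit K \<omega>}"
      have fC: "finite C" "finite C'" using C by (auto simp: \<C>_def C'_def)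
      have "\<forall>K\<in>C'. \<exists>z. z \<in> K \<and> h \<omega> z = 0" by (auto simp: C'_def hit_def)
      then obtain z where z: "\<And>K. K \<in> C' \<Longrightarrow> z K \<in> K \<and> h \<omega> (z K) = 0" by metis
      have inj: "inj_on z C'"
      proof (rule inj_onI)
        fix K L assume KL: "K \<in> C'" "L \<in> C'" "z K = z L"
        then have "K \<inter> L \<noteq> {}" using z by force
        then show "K = L" using KL C by (auto simp: \<C>_def C'_def disjoint_def)
      qed
      have "K \<subseteq> T" if "K \<in> C'" for K
        using that C by (auto simp: \<C>_def C'_def \<K>_def)
      then have sub: "z ` C' \<subseteq> ?Z" using z by blast
      have "(\<Sum>K\<in>C. indicator {\<omega>\<in>space M. hit K \<omega>} \<omega>) = (\<Sum>K\<in>C'. 1 :: ennreal)"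
        using fC \<omega> unfolding C'_def by (intro sum.mono_neutral_cong_right) auto
      also have "\<dots> = emeasure (count_space UNIV) (z ` C')"
        using fC by (simp add: card_image[OF inj])
      also have "\<dots> \<le> ?c" using sub by (intro emeasure_mono) auto
      finally show "(\<Sum>K\<in>C. indicator {\<omega>\<in>space M. hit K \<omega>} \<omega>) \<le> ?c" .
    qed
    have fin: "of_nat (card Y) \<le> ?s" if Y: "finite Y" "Y \<subseteq> ?Z" for Y
    proof -
      obtain e where e: "e > 0" "\<And>x. x \<in> Y \<Longrightarrow> cball x e \<subseteq> T"
        "\<And>x y. x \<in> Y \<Longrightarrow> y \<in> Y \<Longrightarrow> x \<noteq> y \<Longrightarrow> e \<le> dist x y"
        using finite_separation[of Y T] Y T by blast
      \<comment> \<open>Reason for the factor 4: the ball of radius r about the nearby centre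
        \<open>a y\<close> lies within 2 * r of y, so two overlapping balls would put their zeros at
        distance at most 4 * r < e.\<close>
      obtain n where n: "1 / real (Suc n) < e / 4"
        using e(1) nat_approx_posE[of "e / 4"] by auto
      define r where "r = 1 / real (Suc n)"
      have r: "r > 0" "4 * r < e" using n by (auto simp: r_def)
      have "\<exists>d\<in>D. d \<in> ball y r" for y using D(2)[of "ball y r"] r by auto
      then obtain a where a: "\<And>y. a y \<in> D" "\<And>y. dist y (a y) < r" by (metis mem_ball)
      have yK: "y \<in> cball (a y) r" for y using a(2)[of y] by (simp add: dist_commute)
      have Ke: "cball (a y) r \<subseteq> cball y (2 * r)" for y
      proof
        fix x assume "x \<in> cball (a y) r"
        then show "x \<in> cball y (2 * r)"
          using a(2)[of y] dist_triangle[of y x "a y"] by simp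
      qed
      have dj: "cball (a x) r \<inter> cball (a y) r = {}" if "x \<in> Y" "y \<in> Y" "x \<noteq> y" for x y
      proof (rule ccontr)
        assume "cball (a x) r \<inter> cball (a y) r \<noteq> {}"
        then obtain u where "u \<in> cball x (2 * r)" "u \<in> cball y (2 * r)" using Ke by blast
        then have "dist x y \<le> 4 * r"
          using dist_triangle[of x y u] by (simp add: dist_commute)
        then show False using e(3)[OF that] r by simp
      qed
      let ?K = "\<lambda>y. cball (a y) r"
      have inj: "inj_on ?K Y"
      proof (rule inj_onI)
        fix x y assume xy: "x \<in> Y" "y \<in> Y" "?K x = ?K y"
        then show "x = y" using dj[OF xy(1,2)] yK[of x] by blast
      qed
      have "?K y \<subseteq> T" if "y \<in> Y" for y
      proof -
        have "cball y (2 * r) \<subseteq> cball y e" using r by auto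
        then show ?thesis using Ke[of y] e(2)[OF that] by blast
      qed
      moreover have "disjoint (?K ` Y)"
        unfolding disjoint_def using dj by blast
      ultimately have CK: "?K ` Y \<in> \<C>"
        using Y(1) a(1) by (auto simp: \<C>_def \<K>_def r_def)
      have hits: "hit (?K y) \<omega>" if "y \<in> Y" for y
        using that Y yK by (auto simp: hit_def)
      have "of_nat (card Y) = (\<Sum>K\<in>?K ` Y. indicator {\<omega>\<in>space M. hit K \<omega>} \<omega> :: ennreal)"
        using inj hits \<omega> by (simp add: sum.reindex)
      also have "\<dots> \<le> ?s" using CK by (rule SUP_upper)
      finally show ?thesis .
    qed
    show "?c \<le> ?s"
    proof (cases "finite ?Z")
      case True
      then show ?thesis using fin[of ?Z] by (simp add: emeasure_count_space)
    next
      case False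
      \<comment> \<open>An infinite zero set has finite subsets of every size, so the supremum
        dominates every natural number and is infinite.\<close>
      have "of_nat n \<le> ?s" for n
        using infinite_arbitrarily_large[OF False, of n] fin by blast
      then have "(SUP n. of_nat n :: ennreal) \<le> ?s" by (intro SUP_least)
      then have "?s = top" unfolding ennreal_SUP_of_nat_eq_top by (rule top_unique[THEN iffD1])
      then show ?thesis by (metis top_greatest)
    qed
  qed
  have "(\<lambda>\<omega>. SUP C\<in>\<C>. \<Sum>K\<in>C. indicator {\<omega>\<in>space M. hit K \<omega>} \<omega> :: ennreal) \<in> borel_measurable M"
    using cC hitm by (intro borel_measurable_SUP borel_measurable_sum) (auto simp: \<C>_def)
  then show ?thesis using eq by (subst measurable_cong) auto
qed

subsection \<open>The area formula in the complex plane\<close>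

text \<open>The bridge between \<open>real^2\<close>, where matrices, determinants and Sard's
  theorem live, and the complex plane. Both measures agree on boxes, which determines them.\<close>

lemma distr_lborel_vec2_complex:
  "distr (lborel :: (real^2) measure) borel (\<lambda>x. Complex (x $ 1) (x $ 2)) = lborel"
proof (rule lborel_eqI[symmetric])
  have [measurable]: "(\<lambda>x::real^2. Complex (x $ 1) (x $ 2)) \<in> borel_measurable borel"
    by (intro borel_measurable_continuous_onI) (auto simp: Complex_eq intro!: continuous_intros)
  fix l u :: complex
  assume le: "\<And>b. b \<in> Basis \<Longrightarrow> l \<bullet> b \<le> u \<bullet> b"
  let ?v = "\<lambda>z::complex. (\<chi> i. if i = 1 then Re z else Im z) :: real^2"
  have eq: "(\<lambda>x::real^2. Complex (x $ 1) (x $ 2)) -` box l u = box (?v l) (?v u)"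
    by (auto simp: box_def Basis_complex_def Basis_vec_def inner_axis forall_2 axis_eq_axis)
  have B: "(Basis :: (real^2) set) = {axis 1 1, axis 2 1}"
    by (auto simp: Basis_vec_def UNIV_2)
  show "emeasure (distr (lborel :: (real^2) measure) borel (\<lambda>x. Complex (x $ 1) (x $ 2))) (box l u) =
      ennreal (\<Prod>b\<in>Basis. (u - l) \<bullet> b)"
    using le[of 1] le[of \<i>]
    by (subst emeasure_distr)
       (auto simp: eq emeasure_lborel_box_eq B Basis_complex_def inner_axis axis_eq_axis inner_diff_left)
qed simp

text \<open>The real-linear map h -> p * h + q * cnj h has determinant |p|^2 - |q|^2. It is negative
  where |q| > |p|, that is, where the map reverses orientation, so the absolute value is essential
  for harmonic polynomials.\<close>

theorem area_formula_complex:
  fixes F :: "complex \<Rightarrow> complex"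
  assumes der: "\<And>z. (F has_derivative (\<lambda>h. p z * h + q z * cnj h)) (at z)"
    and p: "continuous_on UNIV p" and q: "continuous_on UNIV q"
    and T: "open T"
    and g [measurable]: "g \<in> borel_measurable borel"
  shows "(\<integral>\<^sup>+c. emeasure (count_space UNIV) {z\<in>T. F z = c} * g c \<partial>lborel) =
    (\<integral>\<^sup>+z\<in>T. g (F z) * ennreal \<bar>(cmod (p z))\<^sup>2 - (cmod (q z))\<^sup>2\<bar> \<partial>lborel)"
proof -
  define \<phi> where "\<phi> x = Complex (x $ 1) (x $ 2)" for x :: "real^2"
  define \<psi> where "\<psi> z = ((\<chi> i. if i = 1 then Re z else Im z) :: real^2)" for z :: complex
  have distr: "distr (lborel :: (real^2) measure) borel \<phi> = lborel"
    using distr_lborel_vec2_complex by (simp add: \<phi>_def[abs_def])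
  have \<phi>\<psi>: "\<phi> (\<psi> z) = z" and \<psi>\<phi>: "\<psi> (\<phi> x) = x" for z x
    by (auto simp: vec_eq_iff forall_2 \<phi>_def \<psi>_def)
  have \<phi>_lin: "bounded_linear \<phi>"
    by (intro linear_conv_bounded_linear[THEN iffD1] linearI) (auto simp: complex_eq_iff \<phi>_def)
  have \<psi>_lin: "bounded_linear \<psi>"
    by (intro linear_conv_bounded_linear[THEN iffD1] linearI) (auto simp: vec_eq_iff \<psi>_def)
  have c\<phi>: "continuous_on A \<phi>" for A
    by (rule linear_continuous_on[OF \<phi>_lin])
  have \<phi> [measurable]: "\<phi> \<in> borel_measurable borel"
    using c\<phi> by (intro borel_measurable_continuous_onI)
  have F: "continuous_on A F" for A
    using der by (intro continuous_at_imp_continuous_on ballI) (auto intro: has_derivative_continuous)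
  have [measurable]: "F \<in> borel_measurable borel" "p \<in> borel_measurable borel" "q \<in> borel_measurable borel"
    using F p q by (auto intro: borel_measurable_continuous_onI)
  have [measurable]: "T \<in> sets borel" using T by simp
  have cnt [measurable]: "(\<lambda>c. emeasure (count_space UNIV) {z\<in>T. F z = c}) \<in> borel_measurable borel"
  proof -
    have "continuous_on UNIV (\<lambda>z. F z - c)" for c
      using F by (intro continuous_intros)
    then show ?thesis
      using borel_measurable_count_zeros[of borel "\<lambda>c z. F z - c", OF _ _ T] by simp
  qed
  define f where "f x = \<psi> (F (\<phi> x))" for x
  define f' where "f' x = (\<lambda>h. \<psi> (p (\<phi> x) * \<phi> h + q (\<phi> x) * cnj (\<phi> h)))" for x
  have derf: "(f has_derivative f' x) (at x)" for x
  proof -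
    have "((\<lambda>x. F (\<phi> x)) has_derivative (\<lambda>h. p (\<phi> x) * \<phi> h + q (\<phi> x) * cnj (\<phi> h))) (at x)"
      using has_derivative_compose[OF bounded_linear_imp_has_derivative[OF \<phi>_lin] der[of "\<phi> x"]] .
    from bounded_linear.has_derivative[OF \<psi>_lin this] show ?thesis
      by (simp add: f_def[abs_def] f'_def)
  qed
  \<comment> \<open>The columns are the images p + q of 1 and \<i> * (p - q) of \<i>, split into
    real and imaginary parts.\<close>
  have mat: "matrix (f' x) = (\<chi> i j. if i = 1
      then (if j = 1 then Re (p (\<phi> x)) + Re (q (\<phi> x)) else - Im (p (\<phi> x)) + Im (q (\<phi> x)))
      else (if j = 1 then Im (p (\<phi> x)) + Im (q (\<phi> x)) else Re (p (\<phi> x)) - Re (q (\<phi> x))))" for x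
    by (auto simp: matrix_def f'_def vec_eq_iff forall_2 axis_def \<phi>_def[of "\<chi> i. _ i"] \<psi>_def)
  have det: "det (matrix (f' x)) = (cmod (p (\<phi> x)))\<^sup>2 - (cmod (q (\<phi> x)))\<^sup>2" for x
    unfolding mat det_2 by (simp add: cmod_power2) algebra
  have cont: "continuous_on UNIV (\<lambda>x. matrix (f' x))"
  proof -
    have "continuous_on UNIV (\<lambda>x. p (\<phi> x))" "continuous_on UNIV (\<lambda>x. q (\<phi> x))"
      by (auto intro: continuous_on_compose2[OF p c\<phi>] continuous_on_compose2[OF q c\<phi>])
    then have "continuous_on UNIV (\<lambda>x. matrix (f' x) $ i $ j)" for i j
      unfolding mat by (cases "i = 1"; cases "j = 1") (auto intro!: continuous_intros)
    then have "continuous_on UNIV (\<lambda>x. \<chi> i j. matrix (f' x) $ i $ j)"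
      by (intro continuous_on_vec_lambda)
    then show ?thesis by simp
  qed
  have T': "\<phi> -` T \<in> sets borel"
    using measurable_sets[OF \<phi>, of T] by simp
  have "(\<integral>\<^sup>+c. emeasure (count_space UNIV) {z\<in>T. F z = c} * g c \<partial>lborel)
      = (\<integral>\<^sup>+x. emeasure (count_space UNIV) {z\<in>T. F z = \<phi> x} * g (\<phi> x) \<partial>lborel)"
    by (subst distr[symmetric], subst nn_integral_distr) auto
  also have "\<dots> = (\<integral>\<^sup>+x. emeasure (count_space UNIV) {y\<in>\<phi> -` T. f y = x} * g (\<phi> x) \<partial>lborel)"
  proof (intro nn_integral_cong)
    fix x
    \<comment> \<open>The fibres in the plane and in \<open>real^2\<close> correspond bijectively,
      so the counts agree even when they are infinite.\<close>
    have "bij_betw \<psi> {z\<in>T. F z = \<phi> x} {y\<in>\<phi> -` T. f y = x}"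
    proof (rule bij_betw_byWitness[where f' = \<phi>])
      show "\<psi> ` {z \<in> T. F z = \<phi> x} \<subseteq> {y \<in> \<phi> -` T. f y = x}"
        using \<phi>\<psi> \<psi>\<phi> by (auto simp: f_def)
      show "\<phi> ` {y \<in> \<phi> -` T. f y = x} \<subseteq> {z \<in> T. F z = \<phi> x}"
        using \<phi>\<psi> by (auto simp: f_def)
    qed (use \<phi>\<psi> \<psi>\<phi> in auto)
    then show "emeasure (count_space UNIV) {z\<in>T. F z = \<phi> x} * g (\<phi> x) =
       emeasure (count_space UNIV) {y\<in>\<phi> -` T. f y = x} * g (\<phi> x)"
      by (simp only: emeasure_count_space subset_UNIV bij_betw_finite bij_betw_same_card)
  qed
  also have "\<dots> = (\<integral>\<^sup>+x\<in>\<phi> -` T. g (\<phi> (f x)) * ennreal \<bar>det (matrix (f' x))\<bar> \<partial>lborel)"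
    by (rule area_formula[OF derf cont T']) measurable
  also have "\<dots> = (\<integral>\<^sup>+x. (g (F (\<phi> x)) * ennreal \<bar>(cmod (p (\<phi> x)))\<^sup>2 - (cmod (q (\<phi> x)))\<^sup>2\<bar>) * indicator T (\<phi> x) \<partial>lborel)"
    unfolding det f_def \<phi>\<psi> by (intro nn_integral_cong) (auto split: split_indicator)
  also have "\<dots> = (\<integral>\<^sup>+z\<in>T. g (F z) * ennreal \<bar>(cmod (p z))\<^sup>2 - (cmod (q z))\<^sup>2\<bar> \<partial>lborel)"
    by (subst distr[symmetric], subst nn_integral_distr) auto
  finally show ?thesis .
qed

text \<open>The area formula for z -> c * z: each point has one preimage and the Jacobian is
  |c|^2.\<close>

lemma nn_integral_complex_mult:
  fixes c :: complex
  assumes c: "c \<noteq> 0" and g [measurable]: "g \<in> borel_measurable borel"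
  shows "(\<integral>\<^sup>+w. g w \<partial>lborel) = ennreal ((cmod c)\<^sup>2) * (\<integral>\<^sup>+z. g (c * z) \<partial>lborel)"
proof -
  have "{z. c * z = w} = {w / c}" for w using c by (auto simp: field_simps)
  then have "(\<integral>\<^sup>+w. g w \<partial>lborel) = (\<integral>\<^sup>+w. emeasure (count_space UNIV) {z\<in>UNIV. c * z = w} * g w \<partial>lborel)"
    by simp
  also have "\<dots> = (\<integral>\<^sup>+z\<in>UNIV. g (c * z) * ennreal \<bar>(cmod c)\<^sup>2 - (cmod 0)\<^sup>2\<bar> \<partial>lborel)"
    by (rule area_formula_complex) (auto intro!: derivative_eq_intros)
  also have "\<dots> = ennreal ((cmod c)\<^sup>2) * (\<integral>\<^sup>+z. g (c * z) \<partial>lborel)"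
    by (simp add: nn_integral_multc mult.commute)
  finally show ?thesis .
qed

text \<open>A constant times a Gaussian is Gaussian with variance scaled by |c|^2; the argument of c
  disappears because the density is rotation invariant. This absorbs the factors z^j and cnj z^j in
  front of the coefficients.\<close>

lemma nn_integral_cgauss_mult:
  fixes c :: complex
  assumes c: "c \<noteq> 0" and v: "v > 0" and g [measurable]: "g \<in> borel_measurable borel"
  shows "(\<integral>\<^sup>+z. g (c * z) * ennreal (cgauss v z) \<partial>lborel) =
    (\<integral>\<^sup>+w. g w * ennreal (cgauss (v * (cmod c)\<^sup>2) w) \<partial>lborel)"
proof -
  have "cgauss (v * (cmod c)\<^sup>2) (c * z) = cgauss v z / (cmod c)\<^sup>2" for z
    using c by (simp add: cgauss_def norm_mult power_mult_distrib)
  then have "(\<integral>\<^sup>+w. g w * ennreal (cgauss (v * (cmod c)\<^sup>2) w) \<partial>lborel)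
      = ennreal ((cmod c)\<^sup>2) * (\<integral>\<^sup>+z. g (c * z) * ennreal (cgauss v z / (cmod c)\<^sup>2) \<partial>lborel)"
    using c by (subst nn_integral_complex_mult[OF c]) auto
  also have "\<dots> = (\<integral>\<^sup>+z. g (c * z) * (ennreal ((cmod c)\<^sup>2) * ennreal (cgauss v z / (cmod c)\<^sup>2)) \<partial>lborel)"
    by (subst nn_integral_cmult[symmetric]) (auto simp: ac_simps)
  also have "\<dots> = (\<integral>\<^sup>+z. g (c * z) * ennreal (cgauss v z) \<partial>lborel)"
    using c v by (intro nn_integral_cong) (simp add: ennreal_mult'[symmetric])
  finally show ?thesis ..
qed

subsection \<open>A Gaussian integral in two complex variables\<close>

text \<open>A real 2 by 2 matrix of determinant 1 with c nonzero acts as two successive affine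
  substitutions in one variable, first in w with u fixed, then in u with w fixed. Their area factors
  c^2 and 1/c^2 cancel.\<close>

lemma nn_integral_complex_shear:
  fixes g :: "complex \<Rightarrow> complex \<Rightarrow> ennreal"
  assumes g [measurable]: "case_prod g \<in> borel_measurable borel"
    and c: "c \<noteq> 0" and det: "c * d - s * t = 1" 
  shows "(\<integral>\<^sup>+w. \<integral>\<^sup>+u. g w u \<partial>lborel \<partial>lborel) =
    (\<integral>\<^sup>+w. \<integral>\<^sup>+u. g (of_real c * w + of_real s * u) (of_real t * w + of_real d * u) \<partial>lborel \<partial>lborel)"
proof -
  have gm [measurable]: "case_prod g \<in> borel_measurable (borel \<Otimes>\<^sub>M borel)"
    using g by (simp add: borel_prod)
  have gm2 [measurable]: "(\<lambda>x. g (f x) (h x)) \<in> borel_measurable M"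
    if [measurable]: "f \<in> borel_measurable M" "h \<in> borel_measurable M" for f h and M :: "'b measure"
    using measurable_compose[OF _ gm, of "\<lambda>x. (f x, h x)" M] by simp
  have "(\<integral>\<^sup>+w. \<integral>\<^sup>+u. g (of_real c * w + of_real s * u) (of_real t * w + of_real d * u) \<partial>lborel \<partial>lborel)
     = (\<integral>\<^sup>+u. \<integral>\<^sup>+w. g (of_real c * w + of_real s * u) (of_real t * w + of_real d * u) \<partial>lborel \<partial>lborel)"
    by (rule lborel_pair.Fubini') measurable
  also have "\<dots> = (\<integral>\<^sup>+u. ennreal (1 / c\<^sup>2) * (\<integral>\<^sup>+w. g w (of_real (t / c) * w + of_real (1 / c) * u) \<partial>lborel) \<partial>lborel)"
  proof (intro nn_integral_cong)
    fix u
    \<comment> \<open>With w' = c * w + s * u as the new variable, the second argument is (t/c) * w'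
      + (d - s * t / c) * u, and the determinant condition reduces the last coefficient to
      1/c.\<close>
    have e: "of_real (t / c) * (of_real s * u + of_real c * w) + of_real (1 / c) * u = of_real t * w + of_real d * u" for w :: complex
    proof -
      have "of_real (t / c) * (of_real s * u + of_real c * w) + of_real (1 / c) * u
         = of_real ((1 + s * t) / c) * u + of_real t * w"
        using c by (simp add: field_simps)
      also have "(1 + s * t) / c = d" using c det by (simp add: field_simps)
      finally show ?thesis by simp
    qed
    have "(\<integral>\<^sup>+w. g w (of_real (t / c) * w + of_real (1 / c) * u) \<partial>lborel)
      = ennreal (\<bar>c\<bar> ^ DIM(complex)) * (\<integral>\<^sup>+w. g (of_real s * u + c *\<^sub>R w)
          (of_real (t / c) * (of_real s * u + c *\<^sub>R w) + of_real (1 / c) * u) \<partial>lborel)"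
      by (rule nn_integral_lborel_affine[OF _ c]) measurable
    also have "\<dots> = ennreal (c\<^sup>2) * (\<integral>\<^sup>+w. g (of_real c * w + of_real s * u) (of_real t * w + of_real d * u) \<partial>lborel)"
      unfolding scaleR_conv_of_real e by (simp add: add.commute)
    finally have "ennreal (1 / c\<^sup>2) * (\<integral>\<^sup>+w. g w (of_real (t / c) * w + of_real (1 / c) * u) \<partial>lborel)
      = ennreal (1 / c\<^sup>2 * c\<^sup>2) * (\<integral>\<^sup>+w. g (of_real c * w + of_real s * u) (of_real t * w + of_real d * u) \<partial>lborel)"
      by (simp only:) (simp add: mult.assoc[symmetric] ennreal_mult'[symmetric])
    then show "(\<integral>\<^sup>+w. g (of_real c * w + of_real s * u) (of_real t * w + of_real d * u) \<partial>lborel)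
      = ennreal (1 / c\<^sup>2) * (\<integral>\<^sup>+w. g w (of_real (t / c) * w + of_real (1 / c) * u) \<partial>lborel)"
      using c by simp
  qed
  also have "\<dots> = ennreal (1 / c\<^sup>2) * (\<integral>\<^sup>+w. \<integral>\<^sup>+u. g w (of_real (t / c) * w + of_real (1 / c) * u) \<partial>lborel \<partial>lborel)"
    by (subst nn_integral_cmult, measurable, subst lborel_pair.Fubini', measurable)
  also have "\<dots> = (\<integral>\<^sup>+w. ennreal (1 / c\<^sup>2) * (\<integral>\<^sup>+u. g w (of_real (t / c) * w + of_real (1 / c) * u) \<partial>lborel) \<partial>lborel)"
    by (rule nn_integral_cmult[symmetric]) measurable
  also have "\<dots> = (\<integral>\<^sup>+w. \<integral>\<^sup>+u. g w u \<partial>lborel \<partial>lborel)"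
  proof (intro nn_integral_cong)
    fix w
    show "ennreal (1 / c\<^sup>2) * (\<integral>\<^sup>+u. g w (of_real (t / c) * w + of_real (1 / c) * u) \<partial>lborel) = (\<integral>\<^sup>+u. g w u \<partial>lborel)"
      using c by (subst nn_integral_lborel_affine[where c = "1 / c" and t = "of_real (t / c) * w" and f = "g w"])
        (auto simp: scaleR_conv_of_real power_divide)
  qed
  finally show ?thesis ..
qed

lemma nn_integral_exp_abs_diff:
  assumes p: "p > 0" and r: "r > 0"
  shows "(\<integral>\<^sup>+s. (\<integral>\<^sup>+t. ennreal (exp (- (p * s) - r * t) * \<bar>s - t\<bar>) * indicator {0..} t \<partial>lborel) * indicator {0..} s \<partial>lborel)
     = ennreal ((p\<^sup>2 + r\<^sup>2) / ((p * r)\<^sup>2 * (p + r)))"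
proof -
  \<comment> \<open>The part s \<ge> t: shifting s by t removes the absolute value and leaves a
    Gamma integral in s - t times an exponential in t.\<close>
  have half: "(\<integral>\<^sup>+t. (\<integral>\<^sup>+s. ennreal (exp (- (a * s) - b * t) * (s - t)) * indicator {t..} s \<partial>lborel) * indicator {0..} t \<partial>lborel)
      = ennreal (1 / (a\<^sup>2 * (a + b)))" if a: "a > 0" and b: "b > 0" for a b :: real
  proof -
    have "(\<integral>\<^sup>+s. ennreal (exp (- (a * s) - b * t) * (s - t)) * indicator {t..} s \<partial>lborel)
       = ennreal (exp (- (a + b) * t)) * ennreal (1 / a\<^sup>2)" for t
    proof -
      have "(\<integral>\<^sup>+s. ennreal (exp (- (a * s) - b * t) * (s - t)) * indicator {t..} s \<partial>lborel)
         = (\<integral>\<^sup>+s. ennreal (exp (- (a + b) * t)) * (ennreal (s * exp (- a * s)) * indicator {0..} s) \<partial>lborel)"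
        by (subst nn_integral_real_affine[where c = 1 and t = t])
           (auto intro!: nn_integral_cong split: split_indicator
              simp: ennreal_mult'[symmetric] exp_add[symmetric] algebra_simps)
      then show ?thesis by (simp add: nn_integral_cmult nn_integral_times_exp_Ici[OF a, simplified])
    qed
    then have "(\<integral>\<^sup>+t. (\<integral>\<^sup>+s. ennreal (exp (- (a * s) - b * t) * (s - t)) * indicator {t..} s \<partial>lborel) * indicator {0..} t \<partial>lborel)
      = (\<integral>\<^sup>+t. (ennreal (exp (- (a + b) * t)) * indicator {0..} t) * ennreal (1 / a\<^sup>2) \<partial>lborel)"
      by (simp add: ac_simps)
    also have "\<dots> = ennreal (1 / (a + b)) * ennreal (1 / a\<^sup>2)"
      using a b by (subst nn_integral_multc) (auto simp: nn_integral_exp_Ici[of "a + b", simplified])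
    finally show ?thesis using a b by (simp add: ennreal_mult'[symmetric] mult.commute)
  qed
  have comm: "- (r * t) - p * s = - (p * s) - r * t" for s t by simp
  \<comment> \<open>The regions s \<ge> t and t \<ge> s overlap only on the diagonal, where the
    factor s - t vanishes, so the two parts add up to the full integrand.\<close>
  let ?f = "\<lambda>s t. ennreal (exp (- (p * s) - r * t) * (s - t)) * indicator {t..} s * indicator {0..} t"
  let ?g = "\<lambda>s t. ennreal (exp (- (p * s) - r * t) * (t - s)) * indicator {s..} t * indicator {0..} s"
  have [measurable]: "(\<lambda>x. indicator {f x..} (h x) :: ennreal) \<in> borel_measurable M"
    if [measurable]: "f \<in> borel_measurable M" "h \<in> borel_measurable M" for f h :: "'b \<Rightarrow> real" and M
  proof -
    have "(\<lambda>x. indicator {f x..} (h x) :: ennreal) = (\<lambda>x. if f x \<le> h x then 1 else 0)"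
      by (auto split: split_indicator)
    then show ?thesis by simp
  qed
  have "(\<integral>\<^sup>+s. (\<integral>\<^sup>+t. ennreal (exp (- (p * s) - r * t) * \<bar>s - t\<bar>) * indicator {0..} t \<partial>lborel) * indicator {0..} s \<partial>lborel)
     = (\<integral>\<^sup>+s. \<integral>\<^sup>+t. (?f s t + ?g s t) \<partial>lborel \<partial>lborel)"
    by (subst nn_integral_multc[symmetric], measurable)
       (intro nn_integral_cong, auto split: split_indicator simp: algebra_simps)
  also have "\<dots> = (\<integral>\<^sup>+s. \<integral>\<^sup>+t. ?f s t \<partial>lborel \<partial>lborel) + (\<integral>\<^sup>+s. \<integral>\<^sup>+t. ?g s t \<partial>lborel \<partial>lborel)"
    by (subst nn_integral_add, measurable, subst nn_integral_add, measurable)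
  also have "(\<integral>\<^sup>+s. \<integral>\<^sup>+t. ?f s t \<partial>lborel \<partial>lborel) = (\<integral>\<^sup>+t. \<integral>\<^sup>+s. ?f s t \<partial>lborel \<partial>lborel)"
    by (rule lborel_pair.Fubini') measurable
  also have "\<dots> = ennreal (1 / (p\<^sup>2 * (p + r)))"
    using half[OF p r] by (simp add: nn_integral_multc)
  also have "(\<integral>\<^sup>+s. \<integral>\<^sup>+t. ?g s t \<partial>lborel \<partial>lborel) = ennreal (1 / (r\<^sup>2 * (r + p)))"
    using half[OF r p, unfolded comm] by (simp add: nn_integral_multc)
  also have "ennreal (1 / (p\<^sup>2 * (p + r))) + ennreal (1 / (r\<^sup>2 * (r + p))) = ennreal (1 / (p\<^sup>2 * (p + r)) + 1 / (r\<^sup>2 * (r + p)))"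
    using p r by (intro ennreal_plus[symmetric]) auto
  also have "1 / (p\<^sup>2 * (p + r)) + 1 / (r\<^sup>2 * (r + p)) = (p\<^sup>2 + r\<^sup>2) / ((p * r)\<^sup>2 * (p + r))"
  proof -
    have "1 / (p\<^sup>2 * x) + 1 / (r\<^sup>2 * x) = (p\<^sup>2 + r\<^sup>2) / ((p * r)\<^sup>2 * x)" if "x > 0" for x
      using p r that by (simp add: field_simps)
    from this[of "p + r"] show ?thesis using p r by (simp add: add.commute)
  qed
  finally show ?thesis .
qed

lemma nn_integral_diagonal_gauss_abs_diff:
  assumes p: "p > 0" and r: "r > 0"
  shows "(\<integral>\<^sup>+w. \<integral>\<^sup>+u. ennreal (exp (- (p * (cmod w)\<^sup>2) - r * (cmod u)\<^sup>2) * \<bar>(cmod w)\<^sup>2 - (cmod u)\<^sup>2\<bar>) \<partial>lborel \<partial>lborel)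
    = ennreal (pi\<^sup>2 * (p\<^sup>2 + r\<^sup>2) / ((p * r)\<^sup>2 * (p + r)))"
proof -
  let ?h = "\<lambda>s t. ennreal (exp (- (p * s) - r * t) * \<bar>s - t\<bar>)"
  have "(\<integral>\<^sup>+w. \<integral>\<^sup>+u. ?h ((cmod w)\<^sup>2) ((cmod u)\<^sup>2) \<partial>lborel \<partial>lborel)
     = (\<integral>\<^sup>+w. ennreal pi * (\<integral>\<^sup>+t. ?h ((cmod w)\<^sup>2) t * indicator {0..} t \<partial>lborel) \<partial>lborel)"
    by (intro nn_integral_cong nn_integral_cmod_square) measurable
  also have "\<dots> = ennreal pi * (ennreal pi *
      (\<integral>\<^sup>+s. (\<integral>\<^sup>+t. ?h s t * indicator {0..} t \<partial>lborel) * indicator {0..} s \<partial>lborel))"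
    by (subst nn_integral_cmult, measurable) (subst nn_integral_cmod_square[symmetric], measurable)
  also have "\<dots> = ennreal (pi * (pi * ((p\<^sup>2 + r\<^sup>2) / ((p * r)\<^sup>2 * (p + r)))))"
    unfolding nn_integral_exp_abs_diff[OF p r] by (simp only: ennreal_mult'[OF pi_ge_zero])
  finally show ?thesis by (simp add: power2_eq_square mult.assoc)
qed

text \<open>The substitution w -> c * w + s * u, u -> s * w + c * u with c^2 - s^2 = 1 leaves |w|^2
  - |u|^2 alone. With C = c^2 + s^2 and S = 2 * c * s the cross term acquires the coefficient S * (p
  + r) + 2 * q * C, so it vanishes for S / C = -2 * q / (p + r). Positivity of p * r - q^2 keeps
  this ratio strictly between -1 and 1.\<close>

lemma nn_integral_gauss_abs_diff:
  assumes p: "p > 0" and r: "r > 0" and pos: "p * r - q\<^sup>2 > 0"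
  shows "(\<integral>\<^sup>+w. \<integral>\<^sup>+u. ennreal (exp (- (p * (cmod w)\<^sup>2) - 2 * q * Re (w * cnj u) - r * (cmod u)\<^sup>2) *
      \<bar>(cmod w)\<^sup>2 - (cmod u)\<^sup>2\<bar>) \<partial>lborel \<partial>lborel)
    = ennreal (pi\<^sup>2 * (p\<^sup>2 + r\<^sup>2 - 2 * q\<^sup>2) / ((p * r - q\<^sup>2)\<^sup>2 * sqrt ((p + r)\<^sup>2 - 4 * q\<^sup>2)))"
proof -
  define D where "D = sqrt ((p + r)\<^sup>2 - 4 * q\<^sup>2)"
  have sq: "(p + r)\<^sup>2 - 4 * q\<^sup>2 = (p - r)\<^sup>2 + 4 * (p * r - q\<^sup>2)"
    by algebra
  have sqpos: "(p + r)\<^sup>2 - 4 * q\<^sup>2 > 0"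
    unfolding sq using pos by (intro add_nonneg_pos) auto
  then have D: "D > 0" by (simp add: D_def)
  have D2: "D\<^sup>2 = (p + r)\<^sup>2 - 4 * q\<^sup>2" using sqpos by (simp add: D_def)
  \<comment> \<open>C and S are the hyperbolic cosine and sine of the doubled angle; dividing by D
    normalises C^2 - S^2 to 1.\<close>
  define C where "C = (p + r) / D"
  define S where "S = - 2 * q / D"
  have CS: "C\<^sup>2 - S\<^sup>2 = 1"
  proof -
    have "C\<^sup>2 - S\<^sup>2 = ((p + r)\<^sup>2 - 4 * q\<^sup>2) / D\<^sup>2"
      by (simp add: C_def S_def power_divide power_mult_distrib diff_divide_distrib)
    then show ?thesis using D by (simp add: D2[symmetric])
  qed
  have C0: "C > 0" using p r D by (simp add: C_def)
  \<comment> \<open>Half-angle formulas. Only c is taken as a square root; s is obtained by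
    division, so that it inherits the sign of S, which is opposite to that of q.\<close>
  define c where "c = sqrt ((C + 1) / 2)"
  have c: "c > 0" using C0 by (simp add: c_def)
  have c2: "c\<^sup>2 = (C + 1) / 2" using C0 by (simp add: c_def)
  define s where "s = S / (2 * c)"
  have cs: "2 * c * s = S" using c by (simp add: s_def)
  have s2: "s\<^sup>2 = (C - 1) / 2"
  proof -
    have "s\<^sup>2 * (2 * (C + 1)) = (2 * c * s)\<^sup>2" using c2 by (simp add: power_mult_distrib)
    also have "\<dots> = (C - 1) / 2 * (2 * (C + 1))"
      unfolding cs using CS by (simp add: field_simps power2_eq_square)
    finally show ?thesis using C0 by simp
  qed
  \<comment> \<open>The coefficients after the rotation: their sum is D, their difference is still p
    - r because c^2 - s^2 = 1, and their product is the determinant p * r - q^2.\<close>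
  define P where "P = (D + (p - r)) / 2"
  define R where "R = (D - (p - r)) / 2"
  have PR: "P * R = p * r - q\<^sup>2"
  proof -
    have "4 * (P * R) = D\<^sup>2 - (p - r)\<^sup>2" by (simp add: P_def R_def field_simps power2_eq_square)
    then show ?thesis unfolding D2 sq by simp
  qed
  have PRs: "P + R = D" by (simp add: P_def R_def field_simps)
  have P2R2: "P\<^sup>2 + R\<^sup>2 = p\<^sup>2 + r\<^sup>2 - 2 * q\<^sup>2"
  proof -
    have "P\<^sup>2 + R\<^sup>2 = (P + R)\<^sup>2 - 2 * (P * R)" by algebra
    then show ?thesis unfolding PR PRs D2 by algebra
  qed
  have PRpos: "P > 0" "R > 0"
  proof -
    have "P * R > 0" using PR pos by simp
    then show "P > 0" "R > 0" using PRs D by (auto simp: zero_less_mult_iff)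
  qed
  have CD: "C * D = p + r" and SD: "S * D = - 2 * q" using D by (auto simp: C_def S_def)
  have CSD: "(p + r) * C + 2 * q * S = D"
  proof -
    have "((p + r) * C + 2 * q * S) * D = D * D"
      unfolding distrib_right mult.assoc CD SD using D2 by (simp add: power2_eq_square algebra_simps)
    then show ?thesis using D by simp
  qed
  have cross: "S * (p + r) + 2 * q * C = 0"
    using D by (simp add: C_def S_def)
  have coefP: "p * c\<^sup>2 + q * S + r * s\<^sup>2 = P"
    unfolding c2 s2 P_def using CSD by (simp add: field_simps)
  have coefR: "p * s\<^sup>2 + q * S + r * c\<^sup>2 = R"
    unfolding c2 s2 R_def using CSD by (simp add: field_simps)
  define N where "N w u = Re (w * cnj u)" for w u :: complex
  have n1: "(cmod (of_real x * w + of_real y * u))\<^sup>2 = x\<^sup>2 * (cmod w)\<^sup>2 + 2 * x * y * N w u + y\<^sup>2 * (cmod u)\<^sup>2" for x y w u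
    unfolding cmod_power2 N_def by (simp add: power2_eq_square algebra_simps)
  have n2: "N (of_real c * w + of_real s * u) (of_real s * w + of_real c * u)
     = c * s * (cmod w)\<^sup>2 + (c\<^sup>2 + s\<^sup>2) * N w u + c * s * (cmod u)\<^sup>2" for w u
    unfolding cmod_power2 N_def by (simp add: power2_eq_square algebra_simps)
  have form: "- (p * (cmod (of_real c * w + of_real s * u))\<^sup>2) - 2 * q * N (of_real c * w + of_real s * u) (of_real s * w + of_real c * u)
      - r * (cmod (of_real s * w + of_real c * u))\<^sup>2 = - (P * (cmod w)\<^sup>2) - R * (cmod u)\<^sup>2" for w u
  proof -
    have "c\<^sup>2 + s\<^sup>2 = C" unfolding c2 s2 by (simp add: field_simps)
    then have "p * (cmod (of_real c * w + of_real s * u))\<^sup>2 + 2 * q * N (of_real c * w + of_real s * u) (of_real s * w + of_real c * u)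
      + r * (cmod (of_real s * w + of_real c * u))\<^sup>2
      = (p * c\<^sup>2 + q * (2 * c * s) + r * s\<^sup>2) * (cmod w)\<^sup>2 + (p * s\<^sup>2 + q * (2 * c * s) + r * c\<^sup>2) * (cmod u)\<^sup>2
        + ((2 * c * s) * (p + r) + 2 * q * C) * N w u"
      unfolding n1 n2 by (simp add: algebra_simps)
    then show ?thesis unfolding cs coefP coefR cross by simp
  qed
  have diff: "(cmod (of_real c * w + of_real s * u))\<^sup>2 - (cmod (of_real s * w + of_real c * u))\<^sup>2
      = (cmod w)\<^sup>2 - (cmod u)\<^sup>2" for w u
  proof -
    have "c\<^sup>2 - s\<^sup>2 = 1" unfolding c2 s2 by (simp add: field_simps)
    moreover have "(cmod (of_real c * w + of_real s * u))\<^sup>2 - (cmod (of_real s * w + of_real c * u))\<^sup>2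
      = (c\<^sup>2 - s\<^sup>2) * ((cmod w)\<^sup>2 - (cmod u)\<^sup>2)"
      unfolding n1 by (simp add: algebra_simps)
    ultimately show ?thesis by simp
  qed
  let ?g = "\<lambda>w u. ennreal (exp (- (p * (cmod w)\<^sup>2) - 2 * q * N w u - r * (cmod u)\<^sup>2) * \<bar>(cmod w)\<^sup>2 - (cmod u)\<^sup>2\<bar>)"
  have "(\<integral>\<^sup>+w. \<integral>\<^sup>+u. ?g w u \<partial>lborel \<partial>lborel)
     = (\<integral>\<^sup>+w. \<integral>\<^sup>+u. ?g (of_real c * w + of_real s * u) (of_real s * w + of_real c * u) \<partial>lborel \<partial>lborel)"
  proof (rule nn_integral_complex_shear)
    have "continuous_on UNIV (\<lambda>x. exp (- (p * (cmod (fst x))\<^sup>2) - 2 * q * N (fst x) (snd x) - r * (cmod (snd x))\<^sup>2) *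
        \<bar>(cmod (fst x))\<^sup>2 - (cmod (snd x))\<^sup>2\<bar>)"
      unfolding N_def by (intro continuous_intros)
    then show "case_prod ?g \<in> borel_measurable borel"
      by (auto simp: case_prod_beta' intro!: borel_measurable_continuous_onI)
    show "c * c - s * s = 1" using c2 s2 by (simp add: power2_eq_square field_simps)
  qed (use c in simp)
  also have "\<dots> = ennreal (pi\<^sup>2 * (P\<^sup>2 + R\<^sup>2) / ((P * R)\<^sup>2 * (P + R)))"
    unfolding form diff by (rule nn_integral_diagonal_gauss_abs_diff[OF PRpos])
  also have "\<dots> = ennreal (pi\<^sup>2 * (p\<^sup>2 + r\<^sup>2 - 2 * q\<^sup>2) / ((p * r - q\<^sup>2)\<^sup>2 * D))"
    unfolding P2R2 PR PRs ..
  finally show ?thesis by (simp add: N_def D_def)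
qed

text \<open>One more coefficient is absorbed. Here w is the weighted sum so far; given w, the plain
  sum together with the Gaussian constant term has mean proportional to w with factor \<kappa>, and
  variance V. A term \<zeta> of weight k changes the weighted sum to w' = w + k * \<zeta> and
  contributes to the plain sum so that the mean becomes \<kappa> * w' + (1 - k * \<kappa>) *
  \<zeta>. Conditioning \<zeta> on w' yields the new factor and variance.\<close>

lemma nn_integral_cgauss_step:
  fixes k \<kappa> V S a :: real
  assumes V: "V > 0" and S: "S > 0" and a: "a > 0"
    and f [measurable]: "f \<in> borel_measurable borel"
  defines "S' \<equiv> S + k\<^sup>2 * a"
  shows "(\<integral>\<^sup>+\<zeta>. (\<integral>\<^sup>+w. ennreal (cgauss V (q + \<zeta> + of_real \<kappa> * w)) * f (of_real k * \<zeta> + w) * ennreal (cgauss S w) \<partial>lborel)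
      * ennreal (cgauss a \<zeta>) \<partial>lborel)
    = (\<integral>\<^sup>+w. ennreal (cgauss (V + (1 - k * \<kappa>)\<^sup>2 * (S * a / S')) (q + of_real (\<kappa> + (1 - k * \<kappa>) * (k * a / S')) * w))
        * f w * ennreal (cgauss S' w) \<partial>lborel)"
proof -
  have S': "S' > 0" using S a by (simp add: S'_def add_pos_nonneg)
  have "(\<integral>\<^sup>+\<zeta>. (\<integral>\<^sup>+w. ennreal (cgauss V (q + \<zeta> + of_real \<kappa> * w)) * f (of_real k * \<zeta> + w) * ennreal (cgauss S w) \<partial>lborel)
      * ennreal (cgauss a \<zeta>) \<partial>lborel)
    = (\<integral>\<^sup>+\<zeta>. \<integral>\<^sup>+w. ennreal (cgauss V (q + \<zeta> + of_real \<kappa> * (w - of_real k * \<zeta>))) * f w *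
        ennreal (cgauss S (w - of_real k * \<zeta>)) * ennreal (cgauss a \<zeta>) \<partial>lborel \<partial>lborel)"
  proof (intro nn_integral_cong)
    fix \<zeta>
    have "(\<integral>\<^sup>+w. ennreal (cgauss V (q + \<zeta> + of_real \<kappa> * w)) * f (of_real k * \<zeta> + w) * ennreal (cgauss S w) \<partial>lborel)
       = (\<integral>\<^sup>+w. ennreal (cgauss V (q + \<zeta> + of_real \<kappa> * (w - of_real k * \<zeta>))) * f w * ennreal (cgauss S (w - of_real k * \<zeta>)) \<partial>lborel)"
      by (subst nn_integral_lborel_affine[where c = 1 and t = "- of_real k * \<zeta>"]) auto
    then show "(\<integral>\<^sup>+w. ennreal (cgauss V (q + \<zeta> + of_real \<kappa> * w)) * f (of_real k * \<zeta> + w) * ennreal (cgauss S w) \<partial>lborel)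
      * ennreal (cgauss a \<zeta>) = (\<integral>\<^sup>+w. ennreal (cgauss V (q + \<zeta> + of_real \<kappa> * (w - of_real k * \<zeta>))) * f w *
        ennreal (cgauss S (w - of_real k * \<zeta>)) * ennreal (cgauss a \<zeta>) \<partial>lborel)"
      by (simp add: nn_integral_multc)
  qed
  also have "\<dots> = (\<integral>\<^sup>+w. \<integral>\<^sup>+\<zeta>. ennreal (cgauss V (q + \<zeta> + of_real \<kappa> * (w - of_real k * \<zeta>))) * f w *
        ennreal (cgauss S (w - of_real k * \<zeta>)) * ennreal (cgauss a \<zeta>) \<partial>lborel \<partial>lborel)"
    by (rule lborel_pair.Fubini') measurable
  also have "\<dots> = (\<integral>\<^sup>+w. ennreal (cgauss (V + (1 - k * \<kappa>)\<^sup>2 * (S * a / S')) (q + of_real (\<kappa> + (1 - k * \<kappa>) * (k * a / S')) * w))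
        * f w * ennreal (cgauss S' w) \<partial>lborel)"
  proof (intro nn_integral_cong)
    fix w
    have "(\<integral>\<^sup>+\<zeta>. ennreal (cgauss V (q + \<zeta> + of_real \<kappa> * (w - of_real k * \<zeta>))) * f w *
        ennreal (cgauss S (w - of_real k * \<zeta>)) * ennreal (cgauss a \<zeta>) \<partial>lborel)
      = (\<integral>\<^sup>+\<zeta>. (f w * ennreal (cgauss S' w)) * ennreal (cgauss V ((q + of_real \<kappa> * w) + of_real (1 - k * \<kappa>) * \<zeta>)
          * cgauss (S * a / S') (\<zeta> - of_real (k * a / S') * w)) \<partial>lborel)"
    proof (intro nn_integral_cong)
      fix \<zeta>
      have e: "q + \<zeta> + of_real \<kappa> * (w - of_real k * \<zeta>) = (q + of_real \<kappa> * w) + of_real (1 - k * \<kappa>) * \<zeta>"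
        by (simp add: algebra_simps)
      \<comment> \<open>The joint density of \<zeta> and the new weighted sum, factored so that
        \<zeta> can be integrated out with w held fixed.\<close>
      have "ennreal (cgauss S (w - of_real k * \<zeta>)) * ennreal (cgauss a \<zeta>)
          = ennreal (cgauss S' w) * ennreal (cgauss (S * a / S') (\<zeta> - of_real (k * a / S') * w))"
        using cgauss_mult[OF S a, of w k \<zeta>] S S' a by (simp only: S'_def[symmetric] ennreal_mult'[symmetric] cgauss_nonneg)
      then show "ennreal (cgauss V (q + \<zeta> + of_real \<kappa> * (w - of_real k * \<zeta>))) * f w *
        ennreal (cgauss S (w - of_real k * \<zeta>)) * ennreal (cgauss a \<zeta>) =
        (f w * ennreal (cgauss S' w)) * ennreal (cgauss V ((q + of_real \<kappa> * w) + of_real (1 - k * \<kappa>) * \<zeta>)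
          * cgauss (S * a / S') (\<zeta> - of_real (k * a / S') * w))"
        unfolding e using V by (simp only: ennreal_mult' cgauss_nonneg mult.assoc) (simp only: ac_simps)
    qed
    also have "\<dots> = (f w * ennreal (cgauss S' w)) *
        ennreal (cgauss (V + (1 - k * \<kappa>)\<^sup>2 * (S * a / S')) ((q + of_real \<kappa> * w) + of_real (1 - k * \<kappa>) * (of_real (k * a / S') * w)))"
      using V S a S' by (subst nn_integral_cmult, measurable) (subst nn_integral_cgauss_convolution, auto)
    also have "(q + of_real \<kappa> * w) + of_real (1 - k * \<kappa>) * (of_real (k * a / S') * w) = q + of_real (\<kappa> + (1 - k * \<kappa>) * (k * a / S')) * w"
      by (simp only: of_real_add of_real_mult distrib_right add.assoc mult.assoc)
    finally show "(\<integral>\<^sup>+\<zeta>. ennreal (cgauss V (q + \<zeta> + of_real \<kappa> * (w - of_real k * \<zeta>))) * f w *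
        ennreal (cgauss S (w - of_real k * \<zeta>)) * ennreal (cgauss a \<zeta>) \<partial>lborel)
      = ennreal (cgauss (V + (1 - k * \<kappa>)\<^sup>2 * (S * a / S')) (q + of_real (\<kappa> + (1 - k * \<kappa>) * (k * a / S')) * w))
        * f w * ennreal (cgauss S' w)"
      by (simp only: ac_simps)
  qed
  finally show ?thesis .
qed

subsection \<open>Linear combinations of independent Gaussians\<close>

text \<open>The numbers p, q, r are the entries of the precision matrix of (w, u) when the plain sum
  is set to zero, the inverse of the conditional covariance matrix with entries R1/R3, R2/R3 and
  -R12/R3. Inversion swaps the diagonal, which is why p = R2/K and r = R1/K.\<close>

lemma nn_integral_three_cgauss:
  fixes a b V S T :: real
  assumes V: "V > 0" and S: "S > 0" and T: "T > 0"
  defines "R3 \<equiv> V + a\<^sup>2 * S + b\<^sup>2 * T"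
  defines "R1 \<equiv> R3 * S - (a * S)\<^sup>2" and "R2 \<equiv> R3 * T - (b * T)\<^sup>2" and "R12 \<equiv> (a * S) * (b * T)"
  shows "(\<integral>\<^sup>+w. \<integral>\<^sup>+u. ennreal (cgauss V (of_real a * w + of_real b * u)) * ennreal \<bar>(cmod w)\<^sup>2 - (cmod u)\<^sup>2\<bar> *
      ennreal (cgauss T u) * ennreal (cgauss S w) \<partial>lborel \<partial>lborel) =
    ennreal ((R1\<^sup>2 + R2\<^sup>2 - 2 * R12\<^sup>2) / (pi * R3\<^sup>2 * sqrt ((R1 + R2)\<^sup>2 - 4 * R12\<^sup>2)))"
proof -
  \<comment> \<open>The product of the three variances; pi^3 * K is the joint normalising constant
    of the three densities.\<close>
  define K where "K = S * T * V"
  have K: "K > 0" using V S T by (simp add: K_def)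
  define p where "p = 1 / S + a\<^sup>2 / V"
  define r where "r = 1 / T + b\<^sup>2 / V"
  define q where "q = a * b / V"
  have R3: "R3 > 0" using V S T by (simp add: R3_def add_pos_nonneg)
  have p_eq: "p = R2 / K" unfolding p_def R2_def R3_def K_def using V S T by (simp add: field_simps power2_eq_square)
  have r_eq: "r = R1 / K" unfolding r_def R1_def R3_def K_def using V S T by (simp add: field_simps power2_eq_square)
  have q_eq: "q = R12 / K" unfolding q_def R12_def K_def using V S T by (simp add: field_simps)
  have p: "p > 0" using S V by (simp add: p_def add_pos_nonneg)
  have r: "r > 0" using T V by (simp add: r_def add_pos_nonneg)
  have det: "p * r - q\<^sup>2 = R3 / K"
    unfolding p_def r_def q_def R3_def K_def using V S T by (simp add: field_simps power2_eq_square)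
  have pos: "p * r - q\<^sup>2 > 0" unfolding det using R3 K by simp
  have eq: "ennreal (cgauss V (of_real a * w + of_real b * u)) * ennreal \<bar>(cmod w)\<^sup>2 - (cmod u)\<^sup>2\<bar> *
      ennreal (cgauss T u) * ennreal (cgauss S w) = ennreal (1 / (pi ^ 3 * K)) *
      ennreal (exp (- (p * (cmod w)\<^sup>2) - 2 * q * Re (w * cnj u) - r * (cmod u)\<^sup>2) * \<bar>(cmod w)\<^sup>2 - (cmod u)\<^sup>2\<bar>)" for w u
  proof -
    have "(cmod (of_real a * w + of_real b * u))\<^sup>2 = a\<^sup>2 * (cmod w)\<^sup>2 + 2 * a * b * Re (w * cnj u) + b\<^sup>2 * (cmod u)\<^sup>2"
      unfolding cmod_power2 by (simp add: power2_eq_square algebra_simps)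
    moreover have "- (p * X) - 2 * q * N - r * Y = - (a\<^sup>2 * X + 2 * a * b * N + b\<^sup>2 * Y) / V + - Y / T + - X / S" for X N Y
      using V S T by (simp add: p_def r_def q_def field_simps)
    ultimately have "- (p * (cmod w)\<^sup>2) - 2 * q * Re (w * cnj u) - r * (cmod u)\<^sup>2 =
       - ((cmod (of_real a * w + of_real b * u))\<^sup>2) / V + - ((cmod u)\<^sup>2) / T + - ((cmod w)\<^sup>2) / S"
      by (simp only:)
    then have "exp (- (p * (cmod w)\<^sup>2) - 2 * q * Re (w * cnj u) - r * (cmod u)\<^sup>2) =
       exp (- ((cmod (of_real a * w + of_real b * u))\<^sup>2) / V) * exp (- ((cmod u)\<^sup>2) / T) * exp (- ((cmod w)\<^sup>2) / S)"
      by (simp only: exp_add)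
    then have "cgauss V (of_real a * w + of_real b * u) * \<bar>(cmod w)\<^sup>2 - (cmod u)\<^sup>2\<bar> * cgauss T u * cgauss S w
       = 1 / (pi ^ 3 * K) * (exp (- (p * (cmod w)\<^sup>2) - 2 * q * Re (w * cnj u) - r * (cmod u)\<^sup>2) * \<bar>(cmod w)\<^sup>2 - (cmod u)\<^sup>2\<bar>)"
      by (simp only:) (simp add: cgauss_def K_def power3_eq_cube mult_ac)
    then show ?thesis using V S T K by (simp only: ennreal_mult'[symmetric] ennreal_mult''[symmetric] cgauss_nonneg abs_ge_zero)
       (simp add: ennreal_mult'[symmetric])
  qed
  have "(\<integral>\<^sup>+w. \<integral>\<^sup>+u. ennreal (cgauss V (of_real a * w + of_real b * u)) * ennreal \<bar>(cmod w)\<^sup>2 - (cmod u)\<^sup>2\<bar> *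
      ennreal (cgauss T u) * ennreal (cgauss S w) \<partial>lborel \<partial>lborel)
    = ennreal (1 / (pi ^ 3 * K)) * (\<integral>\<^sup>+w. \<integral>\<^sup>+u. ennreal (exp (- (p * (cmod w)\<^sup>2) - 2 * q * Re (w * cnj u) - r * (cmod u)\<^sup>2) *
      \<bar>(cmod w)\<^sup>2 - (cmod u)\<^sup>2\<bar>) \<partial>lborel \<partial>lborel)"
    unfolding eq by (subst nn_integral_cmult, measurable) (subst nn_integral_cmult, measurable)
  also have "\<dots> = ennreal (1 / (pi ^ 3 * K) * (pi\<^sup>2 * (p\<^sup>2 + r\<^sup>2 - 2 * q\<^sup>2) / ((p * r - q\<^sup>2)\<^sup>2 * sqrt ((p + r)\<^sup>2 - 4 * q\<^sup>2))))"
    unfolding nn_integral_gauss_abs_diff[OF p r pos] using K by (intro ennreal_mult'[symmetric]) simp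
  also have "1 / (pi ^ 3 * K) * (pi\<^sup>2 * (p\<^sup>2 + r\<^sup>2 - 2 * q\<^sup>2) / ((p * r - q\<^sup>2)\<^sup>2 * sqrt ((p + r)\<^sup>2 - 4 * q\<^sup>2)))
     = (R1\<^sup>2 + R2\<^sup>2 - 2 * R12\<^sup>2) / (pi * R3\<^sup>2 * sqrt ((R1 + R2)\<^sup>2 - 4 * R12\<^sup>2))"
  proof -
    have 1: "p\<^sup>2 + r\<^sup>2 - 2 * q\<^sup>2 = (R1\<^sup>2 + R2\<^sup>2 - 2 * R12\<^sup>2) / K\<^sup>2"
      unfolding p_eq r_eq q_eq by (simp add: power_divide add_divide_distrib diff_divide_distrib)
    have "(p + r)\<^sup>2 - 4 * q\<^sup>2 = ((R1 + R2)\<^sup>2 - 4 * R12\<^sup>2) / K\<^sup>2"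
      unfolding p_eq r_eq q_eq add_divide_distrib[symmetric] by (simp add: power_divide diff_divide_distrib add.commute)
    then have 2: "sqrt ((p + r)\<^sup>2 - 4 * q\<^sup>2) = sqrt ((R1 + R2)\<^sup>2 - 4 * R12\<^sup>2) / K"
      using K by (simp add: real_sqrt_divide)
    show ?thesis
      unfolding det 1 2 using K R3 by (simp add: power2_eq_square power3_eq_cube)
  qed
  finally show ?thesis .
qed

section \<open>Product Gaussian measures and weighted sums of the coefficients\<close>

definition cgauss_measure :: "real \<Rightarrow> complex measure" where
  "cgauss_measure v = density lborel (\<lambda>z. ennreal (cgauss v z))"

lemma sets_cgauss_measure [measurable_cong, simp]: "sets (cgauss_measure v) = sets borel"
  by (simp add: cgauss_measure_def)

lemma space_cgauss_measure [simp]: "space (cgauss_measure v) = UNIV"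
  by (simp add: cgauss_measure_def)

lemma nn_integral_cgauss_measure:
  "f \<in> borel_measurable borel \<Longrightarrow>
    (\<integral>\<^sup>+z. f z \<partial>cgauss_measure v) = (\<integral>\<^sup>+z. f z * ennreal (cgauss v z) \<partial>lborel)"
  by (simp add: cgauss_measure_def nn_integral_density mult.commute)

lemma sigma_finite_cgauss_measure: "sigma_finite_measure (cgauss_measure v)"
  unfolding cgauss_measure_def by (subst sigma_finite_measure.sigma_finite_iff_density_finite[OF sigma_finite_lborel]) auto

lemma product_sigma_finite_cgauss: "product_sigma_finite (\<lambda>j. cgauss_measure (v j))"
  by (simp add: product_sigma_finite_def sigma_finite_cgauss_measure)

text \<open>For the terms c j * x j, \<sigma> at 0 and 2 gives the variances of the plain sum and of
  the sum with weights k j, and \<sigma> at 1 their covariance. The right-hand side combines the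
  marginal law of the weighted sum w with the conditional law of the plain sum. The induction
  carries all three conclusions, since positivity of the variance of w and the Cauchy-Schwarz bound
  keep the Gaussian densities nondegenerate. An index of positive weight starts it; afterwards terms
  of weight 0 are harmless. The shift q and the function f vary because each new term is moved into
  them.\<close>

lemma nn_integral_PiM_cgauss:
  fixes c :: "'i \<Rightarrow> complex" and k v :: "'i \<Rightarrow> real"
  defines "\<sigma> \<equiv> \<lambda>J l. \<Sum>j\<in>J. k j ^ l * v j * (cmod (c j))\<^sup>2"
  assumes "finite J" "i0 \<notin> J" and k0: "k i0 > 0"
    and "\<And>j. j \<in> insert i0 J \<Longrightarrow> v j > 0" "\<And>j. j \<in> insert i0 J \<Longrightarrow> c j \<noteq> 0"
    and V: "V > 0" and "f \<in> borel_measurable borel"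
  shows "\<sigma> (insert i0 J) 2 > 0 \<and>
    (\<sigma> (insert i0 J) 1)\<^sup>2 / \<sigma> (insert i0 J) 2 \<le> \<sigma> (insert i0 J) 0 \<and>
    (\<integral>\<^sup>+x. ennreal (cgauss V (q + (\<Sum>j\<in>insert i0 J. c j * x j))) *
        f (\<Sum>j\<in>insert i0 J. of_real (k j) * (c j * x j)) \<partial>PiM (insert i0 J) (\<lambda>j. cgauss_measure (v j))) =
    (\<integral>\<^sup>+w. ennreal (cgauss (V + \<sigma> (insert i0 J) 0 - (\<sigma> (insert i0 J) 1)\<^sup>2 / \<sigma> (insert i0 J) 2)
        (q + of_real (\<sigma> (insert i0 J) 1 / \<sigma> (insert i0 J) 2) * w)) * f w * ennreal (cgauss (\<sigma> (insert i0 J) 2) w) \<partial>lborel)"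
  using assms(2,3,5,6,8)
proof (induction J arbitrary: q f rule: finite_induct)
  case empty
  interpret product_sigma_finite "\<lambda>j. cgauss_measure (v j)" by (rule product_sigma_finite_cgauss)
  note empty(4) [measurable]
  define a where "a = v i0 * (cmod (c i0))\<^sup>2"
  have a: "a > 0" using empty(2,3) by (simp add: a_def)
  have \<sigma>: "\<sigma> {i0} l = k i0 ^ l * a" for l by (simp add: \<sigma>_def a_def)
  \<comment> \<open>A single term is the weighted sum divided by its weight, so the plain sum has no
    conditional variance beyond V.\<close>
  let ?g = "\<lambda>w. ennreal (cgauss V (q + w / of_real (k i0))) * f w"
  have "(\<integral>\<^sup>+x. ennreal (cgauss V (q + (\<Sum>j\<in>{i0}. c j * x j))) *
        f (\<Sum>j\<in>{i0}. of_real (k j) * (c j * x j)) \<partial>PiM {i0} (\<lambda>j. cgauss_measure (v j)))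
     = (\<integral>\<^sup>+y. ennreal (cgauss V (q + c i0 * y)) * f (of_real (k i0) * (c i0 * y)) \<partial>cgauss_measure (v i0))"
    using product_nn_integral_singleton[of "\<lambda>y. ennreal (cgauss V (q + c i0 * y)) * f (of_real (k i0) * (c i0 * y))" i0]
    by simp
  also have "\<dots> = (\<integral>\<^sup>+y. ?g (of_real (k i0) * c i0 * y) * ennreal (cgauss (v i0) y) \<partial>lborel)"
    using k0 by (subst nn_integral_cgauss_measure) (auto simp: mult.assoc)
  also have "\<dots> = (\<integral>\<^sup>+w. ?g w * ennreal (cgauss (v i0 * (cmod (of_real (k i0) * c i0))\<^sup>2) w) \<partial>lborel)"
    using empty(2,3) k0 by (intro nn_integral_cgauss_mult) auto
  also have "v i0 * (cmod (of_real (k i0) * c i0))\<^sup>2 = \<sigma> {i0} 2"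
    by (simp add: \<sigma> a_def norm_mult power_mult_distrib)
  finally show ?case
    using a k0 by (simp add: \<sigma> power2_eq_square)
next
  case (insert i J)
  interpret product_sigma_finite "\<lambda>j. cgauss_measure (v j)" by (rule product_sigma_finite_cgauss)
  note insert.prems(4) [measurable]
  let ?I = "insert i0 J"
  define a where "a = v i * (cmod (c i))\<^sup>2"
  have vi: "v i > 0" and ci: "c i \<noteq> 0" using insert.prems by auto
  then have a: "a > 0" by (simp add: a_def)
  have I: "finite ?I" "i \<notin> ?I" "insert i0 (insert i J) = insert i ?I"
    using insert by auto
  have \<sigma>: "\<sigma> (insert i ?I) l = \<sigma> ?I l + k i ^ l * a" for l
    using I by (simp add: \<sigma>_def a_def)
  have IH: "\<sigma> ?I 2 > 0" "(\<sigma> ?I 1)\<^sup>2 / \<sigma> ?I 2 \<le> \<sigma> ?I 0"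
    "\<And>q f. f \<in> borel_measurable borel \<Longrightarrow> (\<integral>\<^sup>+x. ennreal (cgauss V (q + (\<Sum>j\<in>?I. c j * x j))) *
        f (\<Sum>j\<in>?I. of_real (k j) * (c j * x j)) \<partial>PiM ?I (\<lambda>j. cgauss_measure (v j))) =
    (\<integral>\<^sup>+w. ennreal (cgauss (V + \<sigma> ?I 0 - (\<sigma> ?I 1)\<^sup>2 / \<sigma> ?I 2)
        (q + of_real (\<sigma> ?I 1 / \<sigma> ?I 2) * w)) * f w * ennreal (cgauss (\<sigma> ?I 2) w) \<partial>lborel)"
    using insert.IH[where f = f] insert.IH insert.prems by auto
  define S where "S = \<sigma> ?I 2"
  define W where "W = V + \<sigma> ?I 0 - (\<sigma> ?I 1)\<^sup>2 / \<sigma> ?I 2"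
  define \<kappa> where "\<kappa> = \<sigma> ?I 1 / \<sigma> ?I 2"
  define S' where "S' = S + (k i)\<^sup>2 * a"
  have S: "S > 0" and W: "W > 0" using IH V by (auto simp: S_def W_def)
  have S': "S' > 0" using S a by (simp add: S'_def add_pos_nonneg)
  have S'_eq: "S' = \<sigma> (insert i ?I) 2" by (simp add: S'_def S_def \<sigma>)
  \<comment> \<open>Recursion of the regression factor: covariance over variance, after a term of
    variance \<open>a\<close> and weight \<open>k i\<close> has joined.\<close>
  have \<kappa>': "\<kappa> + (1 - k i * \<kappa>) * (k i * a / S') = \<sigma> (insert i ?I) 1 / \<sigma> (insert i ?I) 2"
    unfolding S'_eq[symmetric] using S S' unfolding \<sigma>[of 1] \<kappa>_def S_def[symmetric]
    by (simp add: field_simps) (simp add: S'_def algebra_simps power2_eq_square)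
  \<comment> \<open>Recursion of the residual variance; clearing the denominators S and S' leaves a
    polynomial identity.\<close>
  have W': "W + (1 - k i * \<kappa>)\<^sup>2 * (S * a / S') =
      V + \<sigma> (insert i ?I) 0 - (\<sigma> (insert i ?I) 1)\<^sup>2 / \<sigma> (insert i ?I) 2"
  proof -
    define m where "m = \<sigma> ?I 1"
    have "a - (m + k i * a)\<^sup>2 / S' = (1 - k i * (m / S))\<^sup>2 * (S * a / S') - m\<^sup>2 / S"
    proof -
      have "(a - (m + k i * a)\<^sup>2 / S') * (S * S') = a * S * S' - (m + k i * a)\<^sup>2 * S"
        using S' by (simp add: algebra_simps)
      also have "\<dots> = (S - k i * m)\<^sup>2 * a - m\<^sup>2 * S'"
        unfolding S'_def by algebra
      also have "\<dots> = ((1 - k i * (m / S))\<^sup>2 * (S * a / S') - m\<^sup>2 / S) * (S * S')"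
        using S S' by (simp add: field_simps power2_eq_square)
      finally show ?thesis using S S' by simp
    qed
    then show ?thesis
      unfolding S'_eq[symmetric] unfolding \<sigma> W_def \<kappa>_def S_def[symmetric] m_def[symmetric] by simp
  qed
  have "(\<integral>\<^sup>+x. ennreal (cgauss V (q + (\<Sum>j\<in>insert i ?I. c j * x j))) *
        f (\<Sum>j\<in>insert i ?I. of_real (k j) * (c j * x j)) \<partial>PiM (insert i ?I) (\<lambda>j. cgauss_measure (v j)))
    = (\<integral>\<^sup>+y. (\<integral>\<^sup>+x. ennreal (cgauss V (q + (\<Sum>j\<in>insert i ?I. c j * (x(i := y)) j))) *
        f (\<Sum>j\<in>insert i ?I. of_real (k j) * (c j * (x(i := y)) j)) \<partial>PiM ?I (\<lambda>j. cgauss_measure (v j))) \<partial>cgauss_measure (v i))"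
    by (rule product_nn_integral_insert_rev[OF I(1,2)]) measurable
  also have "\<dots> = (\<integral>\<^sup>+y. (\<integral>\<^sup>+x. ennreal (cgauss V ((q + c i * y) + (\<Sum>j\<in>?I. c j * x j))) *
        f (of_real (k i) * (c i * y) + (\<Sum>j\<in>?I. of_real (k j) * (c j * x j))) \<partial>PiM ?I (\<lambda>j. cgauss_measure (v j))) \<partial>cgauss_measure (v i))"
  proof -
    have upd: "(\<Sum>j\<in>insert i ?I. h j ((x(i := y)) j)) = h i y + (\<Sum>j\<in>?I. h j (x j))"
      for h :: "'i \<Rightarrow> complex \<Rightarrow> complex" and x y
    proof -
      have "(\<Sum>j\<in>?I. h j ((x(i := y)) j)) = (\<Sum>j\<in>?I. h j (x j))"
        using I(2) by (intro sum.cong) auto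
      then show ?thesis using I by (simp del: fun_upd_apply) simp
    qed
    show ?thesis
      unfolding upd[of "\<lambda>j y. c j * y"] upd[of "\<lambda>j y. of_real (k j) * (c j * y)"] add.assoc ..
  qed
  also have "\<dots> = (\<integral>\<^sup>+y. (\<integral>\<^sup>+w. ennreal (cgauss W (q + c i * y + of_real \<kappa> * w)) *
        f (of_real (k i) * (c i * y) + w) * ennreal (cgauss S w) \<partial>lborel) \<partial>cgauss_measure (v i))"
    unfolding S_def W_def \<kappa>_def by (intro nn_integral_cong IH(3)) measurable
  also have "\<dots> = (\<integral>\<^sup>+y. (\<integral>\<^sup>+w. ennreal (cgauss W (q + c i * y + of_real \<kappa> * w)) *
        f (of_real (k i) * (c i * y) + w) * ennreal (cgauss S w) \<partial>lborel) * ennreal (cgauss (v i) y) \<partial>lborel)"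
    by (rule nn_integral_cgauss_measure) measurable
  also have "\<dots> = (\<integral>\<^sup>+\<zeta>. (\<integral>\<^sup>+w. ennreal (cgauss W (q + \<zeta> + of_real \<kappa> * w)) *
        f (of_real (k i) * \<zeta> + w) * ennreal (cgauss S w) \<partial>lborel) * ennreal (cgauss a \<zeta>) \<partial>lborel)"
    unfolding a_def
    by (rule nn_integral_cgauss_mult[OF ci vi, of "\<lambda>\<zeta>. (\<integral>\<^sup>+w. ennreal (cgauss W (q + \<zeta> + of_real \<kappa> * w)) *
        f (of_real (k i) * \<zeta> + w) * ennreal (cgauss S w) \<partial>lborel)"]) measurable
  also have "\<dots> = (\<integral>\<^sup>+w. ennreal (cgauss (W + (1 - k i * \<kappa>)\<^sup>2 * (S * a / S')) (q + of_real (\<kappa> + (1 - k i * \<kappa>) * (k i * a / S')) * w))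
        * f w * ennreal (cgauss S' w) \<partial>lborel)"
    unfolding S'_def by (rule nn_integral_cgauss_step[OF W S a]) measurable
  finally have "(\<integral>\<^sup>+x. ennreal (cgauss V (q + (\<Sum>j\<in>insert i ?I. c j * x j))) *
        f (\<Sum>j\<in>insert i ?I. of_real (k j) * (c j * x j)) \<partial>PiM (insert i ?I) (\<lambda>j. cgauss_measure (v j)))
    = (\<integral>\<^sup>+w. ennreal (cgauss (V + \<sigma> (insert i ?I) 0 - (\<sigma> (insert i ?I) 1)\<^sup>2 / \<sigma> (insert i ?I) 2)
        (q + of_real (\<sigma> (insert i ?I) 1 / \<sigma> (insert i ?I) 2) * w)) * f w * ennreal (cgauss (\<sigma> (insert i ?I) 2) w) \<partial>lborel)"
    unfolding W' \<kappa>' unfolding S'_eq .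
  moreover have "(\<sigma> (insert i ?I) 1)\<^sup>2 / \<sigma> (insert i ?I) 2 \<le> \<sigma> (insert i ?I) 0"
  proof -
    \<comment> \<open>The Cauchy-Schwarz bound comes from the recursion itself: the new residual
      variance is the old one plus a nonnegative term.\<close>
    have "(1 - k i * \<kappa>)\<^sup>2 * (S * a / S') \<ge> 0" using S S' a by simp
    moreover have "W \<ge> V" using IH by (simp add: W_def)
    ultimately show ?thesis using W' by linarith
  qed
  ultimately show ?case
    using S' unfolding I(3) S'_eq[symmetric] by (simp only: simp_thms)
qed

text \<open>The absolute value couples the two groups, but each enters it only through its weighted
  sum. With group \<open>IB\<close> fixed, its plain sum is a mere shift, so group \<open>IA\<close>
  reduces to one variable w while the variance V becomes W. The same reduction with W in place of V
  turns group \<open>IB\<close> into u.\<close>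

lemma nn_integral_PiM_cgauss_pair:
  fixes c :: "'i \<Rightarrow> complex" and k v :: "'i \<Rightarrow> real"
  assumes fin: "finite JA" "finite JB" and a0: "a0 \<notin> JA" "k a0 > 0" and b0: "b0 \<notin> JB" "k b0 > 0"
    and disj: "IA \<inter> IB = {}" and IA: "IA = insert a0 JA" and IB: "IB = insert b0 JB"
    and v: "\<And>j. j \<in> IA \<union> IB \<Longrightarrow> v j > 0" and c: "\<And>j. j \<in> IA \<union> IB \<Longrightarrow> c j \<noteq> 0"
    and V: "V > 0"
  defines "\<sigma> \<equiv> \<lambda>J l. \<Sum>j\<in>J. k j ^ l * v j * (cmod (c j))\<^sup>2"
  defines "R3 \<equiv> V + \<sigma> IA 0 + \<sigma> IB 0"
  defines "R1 \<equiv> R3 * \<sigma> IA 2 - (\<sigma> IA 1)\<^sup>2" and "R2 \<equiv> R3 * \<sigma> IB 2 - (\<sigma> IB 1)\<^sup>2" and "R12 \<equiv> \<sigma> IA 1 * \<sigma> IB 1"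
  shows "(\<integral>\<^sup>+x. ennreal (cgauss V ((\<Sum>j\<in>IA. c j * x j) + (\<Sum>j\<in>IB. c j * x j))) *
      ennreal \<bar>(cmod (\<Sum>j\<in>IA. of_real (k j) * (c j * x j)))\<^sup>2 - (cmod (\<Sum>j\<in>IB. of_real (k j) * (c j * x j)))\<^sup>2\<bar>
      \<partial>PiM (IA \<union> IB) (\<lambda>j. cgauss_measure (v j))) =
    ennreal ((R1\<^sup>2 + R2\<^sup>2 - 2 * R12\<^sup>2) / (pi * R3\<^sup>2 * sqrt ((R1 + R2)\<^sup>2 - 4 * R12\<^sup>2)))"
proof -
  interpret product_sigma_finite "\<lambda>j. cgauss_measure (v j)" by (rule product_sigma_finite_cgauss)
  have finI: "finite IA" "finite IB" using fin IA IB by auto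
  interpret PB: finite_product_sigma_finite "\<lambda>j. cgauss_measure (v j)" IB by standard (rule finI)
  interpret pair_sigma_finite "PiM IB (\<lambda>j. cgauss_measure (v j))" "lborel :: complex measure" ..
  let ?MA = "PiM IA (\<lambda>j. cgauss_measure (v j))" and ?MB = "PiM IB (\<lambda>j. cgauss_measure (v j))"
  define W where "W = V + \<sigma> IA 0 - (\<sigma> IA 1)\<^sup>2 / \<sigma> IA 2"
  define W' where "W' = W + \<sigma> IB 0 - (\<sigma> IB 1)\<^sup>2 / \<sigma> IB 2"
  define a where "a = \<sigma> IA 1 / \<sigma> IA 2"
  define b where "b = \<sigma> IB 1 / \<sigma> IB 2"
  have \<sigma>_eq: "(\<Sum>j\<in>J. k j ^ l * v j * (cmod (c j))\<^sup>2) = \<sigma> J l" for J l by (simp add: \<sigma>_def)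
  have pA: "\<And>j. j \<in> IA \<Longrightarrow> v j > 0" "\<And>j. j \<in> IA \<Longrightarrow> c j \<noteq> 0"
    and pB: "\<And>j. j \<in> IB \<Longrightarrow> v j > 0" "\<And>j. j \<in> IB \<Longrightarrow> c j \<noteq> 0"
    using v c by auto
  note lemA = nn_integral_PiM_cgauss[OF fin(1) a0(1), of k v c V, unfolded \<sigma>_eq, folded IA, OF a0(2) pA V]
  \<comment> \<open>The zero function is inserted for f just to reach the positivity
    statements.\<close>
  have S: "\<sigma> IA 2 > 0" and SW: "(\<sigma> IA 1)\<^sup>2 / \<sigma> IA 2 \<le> \<sigma> IA 0"
    using lemA[of "\<lambda>_. 0", OF _ _ borel_measurable_const] by simp_all
  have intA: "(\<integral>\<^sup>+x. ennreal (cgauss V (q + (\<Sum>j\<in>IA. c j * x j))) *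
        f (\<Sum>j\<in>IA. of_real (k j) * (c j * x j)) \<partial>?MA) =
       (\<integral>\<^sup>+w. ennreal (cgauss W (q + of_real a * w)) * f w * ennreal (cgauss (\<sigma> IA 2) w) \<partial>lborel)"
    if "f \<in> borel_measurable borel" for q f
    unfolding W_def a_def by (rule lemA[THEN conjunct2, THEN conjunct2, OF _ _ that])
  have W: "W > 0" using SW V by (simp add: W_def)
  note lemB = nn_integral_PiM_cgauss[OF fin(2) b0(1), of k v c W, unfolded \<sigma>_eq, folded IB, OF b0(2) pB W]
  have T: "\<sigma> IB 2 > 0" and TW: "(\<sigma> IB 1)\<^sup>2 / \<sigma> IB 2 \<le> \<sigma> IB 0"
    using lemB[of "\<lambda>_. 0", OF _ _ borel_measurable_const] by simp_all
  have intB: "(\<integral>\<^sup>+x. ennreal (cgauss W (q + (\<Sum>j\<in>IB. c j * x j))) *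
        f (\<Sum>j\<in>IB. of_real (k j) * (c j * x j)) \<partial>?MB) =
       (\<integral>\<^sup>+u. ennreal (cgauss W' (q + of_real b * u)) * f u * ennreal (cgauss (\<sigma> IB 2) u) \<partial>lborel)"
    if "f \<in> borel_measurable borel" for q f
    unfolding W'_def b_def by (rule lemB[THEN conjunct2, THEN conjunct2, OF _ _ that])
  have W': "W' > 0" using TW W by (simp add: W'_def)
  define sA where "sA x = (\<Sum>j\<in>IA. c j * x j)" for x
  define sB where "sB x = (\<Sum>j\<in>IB. c j * x j)" for x
  define dA where "dA x = (\<Sum>j\<in>IA. of_real (k j) * (c j * x j))" for x
  define dB where "dB x = (\<Sum>j\<in>IB. of_real (k j) * (c j * x j))" for x
  have [measurable]: "sB \<in> borel_measurable ?MB" "dB \<in> borel_measurable ?MB"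
    unfolding sB_def dB_def by measurable
  let ?h = "\<lambda>x. ennreal (cgauss V (sA x + sB x)) * ennreal \<bar>(cmod (dA x))\<^sup>2 - (cmod (dB x))\<^sup>2\<bar>"
  have [measurable]: "sA \<in> borel_measurable (PiM (IB \<union> IA) (\<lambda>j. cgauss_measure (v j)))"
     "sB \<in> borel_measurable (PiM (IB \<union> IA) (\<lambda>j. cgauss_measure (v j)))"
     "dA \<in> borel_measurable (PiM (IB \<union> IA) (\<lambda>j. cgauss_measure (v j)))"
     "dB \<in> borel_measurable (PiM (IB \<union> IA) (\<lambda>j. cgauss_measure (v j)))"
    unfolding sA_def sB_def dA_def dB_def by measurable
  \<comment> \<open>This order of the union makes group \<open>IA\<close> the inner
    integral.\<close>
  have "(\<integral>\<^sup>+x. ?h x \<partial>PiM (IB \<union> IA) (\<lambda>j. cgauss_measure (v j))) =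
     (\<integral>\<^sup>+x. (\<integral>\<^sup>+y. ?h (merge IB IA (x, y)) \<partial>?MA) \<partial>?MB)"
    using disj finI by (intro product_nn_integral_fold) (auto simp: Int_commute)
  also have "\<dots> = (\<integral>\<^sup>+x. (\<integral>\<^sup>+y. ennreal (cgauss V (sB x + sA y)) * ennreal \<bar>(cmod (dA y))\<^sup>2 - (cmod (dB x))\<^sup>2\<bar> \<partial>?MA) \<partial>?MB)"
  proof -
    have "merge IB IA (x, y) j = x j" if "j \<in> IB" for x y :: "'i \<Rightarrow> complex" and j
      using that by (simp add: merge_def)
    moreover have "merge IB IA (x, y) j = y j" if "j \<in> IA" for x y :: "'i \<Rightarrow> complex" and j
      using that disj by (auto simp: merge_def)
    ultimately have "sA (merge IB IA (x, y)) = sA y" "dA (merge IB IA (x, y)) = dA y"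
      "sB (merge IB IA (x, y)) = sB x" "dB (merge IB IA (x, y)) = dB x" for x y
      by (auto simp: sA_def sB_def dA_def dB_def intro!: sum.cong)
    then show ?thesis by (simp add: add.commute)
  qed
  also have "\<dots> = (\<integral>\<^sup>+x. (\<integral>\<^sup>+w. ennreal (cgauss W (sB x + of_real a * w)) * ennreal \<bar>(cmod w)\<^sup>2 - (cmod (dB x))\<^sup>2\<bar> *
      ennreal (cgauss (\<sigma> IA 2) w) \<partial>lborel) \<partial>?MB)"
    unfolding sA_def dA_def
    by (intro nn_integral_cong intA[where f = "\<lambda>w. ennreal \<bar>(cmod w)\<^sup>2 - (cmod (dB _))\<^sup>2\<bar>"]) measurable
  also have "\<dots> = (\<integral>\<^sup>+w. (\<integral>\<^sup>+x. ennreal (cgauss W (sB x + of_real a * w)) * ennreal \<bar>(cmod w)\<^sup>2 - (cmod (dB x))\<^sup>2\<bar> *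
      ennreal (cgauss (\<sigma> IA 2) w) \<partial>?MB) \<partial>lborel)"
    by (rule Fubini'[symmetric]) measurable
  also have "\<dots> = (\<integral>\<^sup>+w. (\<integral>\<^sup>+x. ennreal (cgauss W (of_real a * w + sB x)) * ennreal \<bar>(cmod w)\<^sup>2 - (cmod (dB x))\<^sup>2\<bar> \<partial>?MB) *
      ennreal (cgauss (\<sigma> IA 2) w) \<partial>lborel)"
    by (subst nn_integral_multc, measurable) (simp add: add.commute)
  also have "\<dots> = (\<integral>\<^sup>+w. (\<integral>\<^sup>+u. ennreal (cgauss W' (of_real a * w + of_real b * u)) * ennreal \<bar>(cmod w)\<^sup>2 - (cmod u)\<^sup>2\<bar> *
      ennreal (cgauss (\<sigma> IB 2) u) \<partial>lborel) * ennreal (cgauss (\<sigma> IA 2) w) \<partial>lborel)"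
  proof (rule nn_integral_cong)
    fix w :: complex
    have "(\<integral>\<^sup>+x. ennreal (cgauss W (of_real a * w + sB x)) * ennreal \<bar>(cmod w)\<^sup>2 - (cmod (dB x))\<^sup>2\<bar> \<partial>?MB)
      = (\<integral>\<^sup>+u. ennreal (cgauss W' (of_real a * w + of_real b * u)) * ennreal \<bar>(cmod w)\<^sup>2 - (cmod u)\<^sup>2\<bar> *
      ennreal (cgauss (\<sigma> IB 2) u) \<partial>lborel)"
      unfolding sB_def dB_def
      by (rule intB[where f = "\<lambda>u. ennreal \<bar>(cmod w)\<^sup>2 - (cmod u)\<^sup>2\<bar>"]) measurable
    then show "(\<integral>\<^sup>+x. ennreal (cgauss W (of_real a * w + sB x)) * ennreal \<bar>(cmod w)\<^sup>2 - (cmod (dB x))\<^sup>2\<bar> \<partial>?MB) *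
      ennreal (cgauss (\<sigma> IA 2) w) = (\<integral>\<^sup>+u. ennreal (cgauss W' (of_real a * w + of_real b * u)) * ennreal \<bar>(cmod w)\<^sup>2 - (cmod u)\<^sup>2\<bar> *
      ennreal (cgauss (\<sigma> IB 2) u) \<partial>lborel) * ennreal (cgauss (\<sigma> IA 2) w)" by simp
  qed
  also have "\<dots> = (\<integral>\<^sup>+w. \<integral>\<^sup>+u. ennreal (cgauss W' (of_real a * w + of_real b * u)) * ennreal \<bar>(cmod w)\<^sup>2 - (cmod u)\<^sup>2\<bar> *
      ennreal (cgauss (\<sigma> IB 2) u) * ennreal (cgauss (\<sigma> IA 2) w) \<partial>lborel \<partial>lborel)"
    by (subst nn_integral_multc, measurable)
  also have "\<dots> = ennreal ((R1\<^sup>2 + R2\<^sup>2 - 2 * R12\<^sup>2) / (pi * R3\<^sup>2 * sqrt ((R1 + R2)\<^sup>2 - 4 * R12\<^sup>2)))"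
  proof -
    have aS: "a * \<sigma> IA 2 = \<sigma> IA 1" and bT: "b * \<sigma> IB 2 = \<sigma> IB 1"
      using S T by (auto simp: a_def b_def)
    have "a\<^sup>2 * \<sigma> IA 2 = (\<sigma> IA 1)\<^sup>2 / \<sigma> IA 2" "b\<^sup>2 * \<sigma> IB 2 = (\<sigma> IB 1)\<^sup>2 / \<sigma> IB 2"
      using S T by (auto simp: a_def b_def power2_eq_square)
    \<comment> \<open>The variance explained by the two weighted sums, subtracted in W and W',
      returns here and restores the total variance.\<close>
    then have r3: "W' + a\<^sup>2 * \<sigma> IA 2 + b\<^sup>2 * \<sigma> IB 2 = R3"
      by (simp add: W'_def W_def R3_def)
    show ?thesis
      unfolding nn_integral_three_cgauss[OF W' S T] r3 aS bT R1_def[symmetric] R2_def[symmetric] R12_def[symmetric] ..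
  qed
  finally show ?thesis unfolding sA_def sB_def dA_def dB_def by (simp only: Un_commute)
qed

text \<open>Multiplying the two derivatives by z and cnj z turns them into sums of the same terms as
  the polynomial, weighted by degree. The Jacobian thereby gains |z|^2, and dividing it out produces
  the factor 1/|z|^2 of the density. The smoothing variance is \<open>\<alpha> 0\<close>.\<close>

lemma nn_integral_density_at:
  fixes z :: complex
  assumes m: "1 \<le> m" and n: "1 \<le> n" and z: "z \<noteq> 0"
    and \<alpha>: "\<And>j. j \<le> n \<Longrightarrow> \<alpha> j > 0" and \<beta>: "\<And>j. j \<le> m \<Longrightarrow> \<beta> j > 0"
  shows "(\<integral>\<^sup>+x. ennreal (cgauss (\<alpha> 0) ((\<Sum>j=1..n. x (Inl j) * z ^ j) + (\<Sum>j\<le>m. x (Inr j) * cnj z ^ j))) *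
      ennreal \<bar>(cmod (\<Sum>j=1..n. of_nat j * x (Inl j) * z ^ (j - 1)))\<^sup>2 -
        (cmod (\<Sum>j\<le>m. of_nat j * x (Inr j) * cnj z ^ (j - 1)))\<^sup>2\<bar>
      \<partial>PiM (Inl ` {1..n} \<union> Inr ` {..m}) (\<lambda>i. cgauss_measure (case_sum \<alpha> \<beta> i)))
    = ennreal (zero_density n m \<alpha> \<beta> z)"
proof -
  define c where "c = case_sum (\<lambda>j::nat. z ^ j) (\<lambda>j::nat. cnj z ^ j)"
  define k :: "nat + nat \<Rightarrow> real" where "k = case_sum real real"
  define v where "v = case_sum \<alpha> \<beta>"
  define IA :: "(nat + nat) set" where "IA = Inl ` {1..n}"
  define IB :: "(nat + nat) set" where "IB = Inr ` {..m}"
  let ?M = "PiM (IA \<union> IB) (\<lambda>i. cgauss_measure (v i))"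
  define \<sigma> where "\<sigma> J l = (\<Sum>j\<in>J. k j ^ l * v j * (cmod (c j))\<^sup>2)" for J and l :: nat
  have cm: "(cmod (z ^ j))\<^sup>2 = cmod z ^ (2 * j)" "(cmod (cnj z ^ j))\<^sup>2 = cmod z ^ (2 * j)" for j
    by (simp_all add: norm_power power_mult[symmetric] mult.commute)
  \<comment> \<open>Degree 1 serves as the index of positive weight; it is present in both groups
    because n and m are at least 1. In the second group the constant term, of weight 0, stays among
    the remaining indices.\<close>
  have IA': "IA = insert (Inl 1) (Inl ` {2..n})"
  proof -
    have "{1..n} = insert 1 {2..n}" using n by auto
    then show ?thesis by (simp add: IA_def)
  qed
  have IB': "IB = insert (Inr 1) (Inr ` ({..m} - {1}))"
  proof -
    have "{..m} = insert 1 ({..m} - {1})" using m by auto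
    then show ?thesis unfolding IB_def by (metis image_insert)
  qed
  have sA: "\<sigma> IA l = s_k n \<alpha> l z" for l
    unfolding \<sigma>_def IA_def s_k_def by (subst sum.reindex) (auto simp: k_def v_def c_def cm)
  have sB: "\<sigma> IB l = (\<Sum>j\<le>m. real j ^ l * \<beta> j * cmod z ^ (2 * j))" for l
    unfolding \<sigma>_def IB_def by (subst sum.reindex) (auto simp: k_def v_def c_def cm)
  \<comment> \<open>The term of degree 0 drops out only for positive l; for l = 0 it contributes
    \<open>\<beta> 0\<close>, as 0^0 = 1, and belongs to r3.\<close>
  have sB': "\<sigma> IB l = s_k m \<beta> l z" if "l > 0" for l
    unfolding sB s_k_def using that by (intro sum.mono_neutral_right) auto
  have r3: "\<alpha> 0 + \<sigma> IA 0 + \<sigma> IB 0 = r3 n m \<alpha> \<beta> z"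
  proof -
    have "(\<Sum>j\<le>n. \<alpha> j * cmod z ^ (2 * j)) = \<alpha> 0 + (\<Sum>j=1..n. \<alpha> j * cmod z ^ (2 * j))"
      by (simp add: sum.atMost_shift sum.atLeast1_atMost_eq)
    then show ?thesis by (simp add: sA sB r3_def s_k_def)
  qed
  define a b d e where "a = r1 n m \<alpha> \<beta> z" and "b = r2 n m \<alpha> \<beta> z" and "d = r12 n m \<alpha> \<beta> z" and "e = r3 n m \<alpha> \<beta> z"
  let ?g = "\<lambda>x. ennreal (cgauss (\<alpha> 0) ((\<Sum>j\<in>IA. c j * x j) + (\<Sum>j\<in>IB. c j * x j))) *
      ennreal \<bar>(cmod (\<Sum>j\<in>IA. of_real (k j) * (c j * x j)))\<^sup>2 - (cmod (\<Sum>j\<in>IB. of_real (k j) * (c j * x j)))\<^sup>2\<bar>"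
  have int: "(\<integral>\<^sup>+x. ?g x \<partial>?M) = ennreal ((a\<^sup>2 + b\<^sup>2 - 2 * d\<^sup>2) / (pi * e\<^sup>2 * sqrt ((a + b)\<^sup>2 - 4 * d\<^sup>2)))"
  proof -
    have vpos: "v j > 0" if "j \<in> IA \<union> IB" for j
      using that \<alpha> \<beta> by (auto simp: v_def IA_def IB_def)
    have cnz: "c j \<noteq> 0" if "j \<in> IA \<union> IB" for j
      using that z by (auto simp: c_def IA_def IB_def)
    have disj: "IA \<inter> IB = {}" by (auto simp: IA_def IB_def)
    have a0: "(Inl 1 :: nat + nat) \<notin> Inl ` {2..n}" "k (Inl 1) > 0"
      and b0: "(Inr 1 :: nat + nat) \<notin> Inr ` ({..m} - {1})" "k (Inr 1) > 0"
      by (auto simp: k_def)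
    have "(\<integral>\<^sup>+x. ?g x \<partial>?M) = ennreal ((((\<alpha> 0 + \<sigma> IA 0 + \<sigma> IB 0) * \<sigma> IA 2 - (\<sigma> IA 1)\<^sup>2)\<^sup>2 + ((\<alpha> 0 + \<sigma> IA 0 + \<sigma> IB 0) * \<sigma> IB 2 - (\<sigma> IB 1)\<^sup>2)\<^sup>2
        - 2 * (\<sigma> IA 1 * \<sigma> IB 1)\<^sup>2) / (pi * (\<alpha> 0 + \<sigma> IA 0 + \<sigma> IB 0)\<^sup>2 *
        sqrt ((((\<alpha> 0 + \<sigma> IA 0 + \<sigma> IB 0) * \<sigma> IA 2 - (\<sigma> IA 1)\<^sup>2) + ((\<alpha> 0 + \<sigma> IA 0 + \<sigma> IB 0) * \<sigma> IB 2 - (\<sigma> IB 1)\<^sup>2))\<^sup>2 - 4 * (\<sigma> IA 1 * \<sigma> IB 1)\<^sup>2)))"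
      unfolding \<sigma>_def
      by (rule nn_integral_PiM_cgauss_pair[OF _ _ a0 b0 disj IA' IB' _ _ \<alpha>[OF le0]]) (auto simp: vpos cnz)
    then show ?thesis
      unfolding r3 unfolding sA sB'[OF zero_less_one] sB'[OF pos2] a_def b_def d_def e_def r1_def r2_def r12_def .
  qed
  have PA: "(\<Sum>j\<in>IA. c j * x j) = (\<Sum>j=1..n. x (Inl j) * z ^ j)"
    and PB: "(\<Sum>j\<in>IB. c j * x j) = (\<Sum>j\<le>m. x (Inr j) * cnj z ^ j)" for x :: "nat + nat \<Rightarrow> complex"
    unfolding IA_def IB_def by (subst sum.reindex; auto simp: c_def mult.commute)+
  \<comment> \<open>At j = 0 the truncated exponent does no harm, because the factor
    \<open>of_nat j\<close> is zero.\<close>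
  have pw: "of_nat j * (w ^ j * y) = w * (of_nat j * y * w ^ (j - 1))" for w y :: complex and j
    by (cases j) auto
  have DA: "(\<Sum>j\<in>IA. of_real (k j) * (c j * x j)) = z * (\<Sum>j=1..n. of_nat j * x (Inl j) * z ^ (j - 1))"
    for x :: "nat + nat \<Rightarrow> complex"
  proof -
    have "(\<Sum>j\<in>IA. of_real (k j) * (c j * x j)) = (\<Sum>j=1..n. of_nat j * (z ^ j * x (Inl j)))"
      unfolding IA_def by (subst sum.reindex) (auto simp: c_def k_def)
    then show ?thesis unfolding pw sum_distrib_left .
  qed
  have DB: "(\<Sum>j\<in>IB. of_real (k j) * (c j * x j)) = cnj z * (\<Sum>j\<le>m. of_nat j * x (Inr j) * cnj z ^ (j - 1))"
    for x :: "nat + nat \<Rightarrow> complex"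
  proof -
    have "(\<Sum>j\<in>IB. of_real (k j) * (c j * x j)) = (\<Sum>j\<le>m. of_nat j * (cnj z ^ j * x (Inr j)))"
      unfolding IB_def by (subst sum.reindex) (auto simp: c_def k_def)
    then show ?thesis unfolding pw sum_distrib_left .
  qed
  let ?f = "\<lambda>x. ennreal (cgauss (\<alpha> 0) ((\<Sum>j=1..n. x (Inl j) * z ^ j) + (\<Sum>j\<le>m. x (Inr j) * cnj z ^ j))) *
      ennreal \<bar>(cmod (\<Sum>j=1..n. of_nat j * x (Inl j) * z ^ (j - 1)))\<^sup>2 -
        (cmod (\<Sum>j\<le>m. of_nat j * x (Inr j) * cnj z ^ (j - 1)))\<^sup>2\<bar>"
  have z2: "(cmod z)\<^sup>2 > 0" using z by simp
  have fg: "?f x = ennreal (1 / (cmod z)\<^sup>2) * ?g x" for x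
  proof -
    have "\<bar>(cmod (z * s))\<^sup>2 - (cmod (cnj z * t))\<^sup>2\<bar> = (cmod z)\<^sup>2 * \<bar>(cmod s)\<^sup>2 - (cmod t)\<^sup>2\<bar>" for s t
      using z2 by (simp add: norm_mult power_mult_distrib right_diff_distrib[symmetric] abs_mult)
    then have key: "ennreal \<bar>(cmod s)\<^sup>2 - (cmod t)\<^sup>2\<bar> = ennreal (1 / (cmod z)\<^sup>2) * ennreal \<bar>(cmod (z * s))\<^sup>2 - (cmod (cnj z * t))\<^sup>2\<bar>" for s t
      using z2 by (simp add: ennreal_mult'[symmetric])
    have "C * ennreal \<bar>(cmod s)\<^sup>2 - (cmod t)\<^sup>2\<bar> =
        ennreal (1 / (cmod z)\<^sup>2) * (C * ennreal \<bar>(cmod (z * s))\<^sup>2 - (cmod (cnj z * t))\<^sup>2\<bar>)" for C s t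
      unfolding key[of s t] by (rule mult.left_commute)
    then show ?thesis unfolding PA PB DA DB .
  qed
  have "(\<integral>\<^sup>+x. ?f x \<partial>?M) = ennreal (1 / (cmod z)\<^sup>2) * (\<integral>\<^sup>+x. ?g x \<partial>?M)"
    unfolding fg by (rule nn_integral_cmult) measurable
  also have "\<dots> = ennreal (1 / (cmod z)\<^sup>2 * ((a\<^sup>2 + b\<^sup>2 - 2 * d\<^sup>2) / (pi * e\<^sup>2 * sqrt ((a + b)\<^sup>2 - 4 * d\<^sup>2))))"
    unfolding int by (rule ennreal_mult'[symmetric]) simp
  also have "1 / (cmod z)\<^sup>2 * ((a\<^sup>2 + b\<^sup>2 - 2 * d\<^sup>2) / (pi * e\<^sup>2 * sqrt ((a + b)\<^sup>2 - 4 * d\<^sup>2))) = zero_density n m \<alpha> \<beta> z"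
    unfolding zero_density_def Let_def a_def[symmetric] b_def[symmetric] d_def[symmetric] e_def[symmetric] by simp
  finally show ?thesis by (simp add: IA_def IB_def v_def)
qed

subsection \<open>Expected number of zeros\<close>

lemma num_zeros_eq_count: "num_zeros H T = emeasure (count_space UNIV) {z\<in>T. H z = 0}"
  by (auto simp: num_zeros_def emeasure_count_space)

lemma has_derivative_harm:
  fixes a b :: "nat \<Rightarrow> complex"
  shows "((\<lambda>z. (\<Sum>j\<in>I. a j * z ^ j) + (\<Sum>j\<in>J. b j * cnj z ^ j)) has_derivative
    (\<lambda>h. (\<Sum>j\<in>I. of_nat j * a j * z ^ (j - 1)) * h + (\<Sum>j\<in>J. of_nat j * b j * cnj z ^ (j - 1)) * cnj h)) (at z)"
proof -
  have D: "((\<lambda>w. \<Sum>j\<in>K. c j * w ^ j) has_field_derivative (\<Sum>j\<in>K. of_nat j * c j * w ^ (j - 1))) (at w)"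
    for c :: "nat \<Rightarrow> complex" and K w
    by (auto intro!: derivative_eq_intros sum.cong)
  have 1: "((\<lambda>z. \<Sum>j\<in>I. a j * z ^ j) has_derivative (\<lambda>h. (\<Sum>j\<in>I. of_nat j * a j * z ^ (j - 1)) * h)) (at z)"
    using D[of a I z] by (simp add: has_field_derivative_def)
  have 2: "((\<lambda>z. \<Sum>j\<in>J. b j * cnj z ^ j) has_derivative (\<lambda>h. (\<Sum>j\<in>J. of_nat j * b j * cnj z ^ (j - 1)) * cnj h)) (at z)"
    using has_derivative_compose[OF bounded_linear_imp_has_derivative[OF bounded_linear_cnj]
        D[of b J "cnj z", unfolded has_field_derivative_def]] .
  from has_derivative_add[OF 1 2] show ?thesis .
qed

text \<open>With the other coefficients fixed, the zeros for constant term y are the solutions of -F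
  z = y, so averaging over y is the area formula for -F weighted by the density of y. Density and
  Jacobian are unchanged under the sign, which therefore disappears. The update overwrites
  \<open>a 0\<close>, and accordingly the right-hand sums start at 1.\<close>

lemma nn_integral_num_zeros_constant_term:
  fixes a b :: "nat \<Rightarrow> complex"
  assumes T: "open T"
  shows "(\<integral>\<^sup>+y. num_zeros (harm_poly n m (a(0 := y)) b) T \<partial>cgauss_measure v) =
    (\<integral>\<^sup>+z\<in>T. ennreal (cgauss v ((\<Sum>j=1..n. a j * z ^ j) + (\<Sum>j\<le>m. b j * cnj z ^ j))) *
      ennreal \<bar>(cmod (\<Sum>j=1..n. of_nat j * a j * z ^ (j - 1)))\<^sup>2 -
        (cmod (\<Sum>j\<le>m. of_nat j * b j * cnj z ^ (j - 1)))\<^sup>2\<bar> \<partial>lborel)"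
proof -
  define F where "F z = (\<Sum>j=1..n. a j * z ^ j) + (\<Sum>j\<le>m. b j * cnj z ^ j)" for z
  define p where "p z = (\<Sum>j=1..n. of_nat j * a j * z ^ (j - 1))" for z
  define q where "q z = (\<Sum>j\<le>m. of_nat j * b j * cnj z ^ (j - 1))" for z
  have harm: "harm_poly n m (a(0 := y)) b z = F z + y" for y z
  proof -
    have "(\<Sum>j\<le>n. (a(0 := y)) j * z ^ j) = y + (\<Sum>j=1..n. a j * z ^ j)"
      by (simp add: sum.atMost_shift sum.atLeast1_atMost_eq)
    then show ?thesis by (simp add: harm_poly_def F_def del: fun_upd_apply)
  qed
  have cont: "continuous_on UNIV F" "continuous_on UNIV p" "continuous_on UNIV q"
    unfolding F_def p_def q_def by (intro continuous_intros)+
  have count: "num_zeros (harm_poly n m (a(0 := y)) b) T = emeasure (count_space UNIV) {z\<in>T. - F z = y}" for y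
    unfolding num_zeros_eq_count harm by (intro arg_cong[where f = "emeasure (count_space UNIV)"]) (auto simp: add_eq_0_iff)
  have "(\<lambda>y. emeasure (count_space UNIV) {z\<in>T. F z + y = 0}) \<in> borel_measurable borel"
    using cont by (intro borel_measurable_count_zeros T) (auto intro!: continuous_intros)
  moreover have "{z\<in>T. F z + y = 0} = {z\<in>T. - F z = y}" for y
    by (auto simp: add_eq_0_iff)
  ultimately have meas [measurable]: "(\<lambda>y. emeasure (count_space UNIV) {z\<in>T. - F z = y}) \<in> borel_measurable borel"
    by simp
  have "(\<integral>\<^sup>+y. num_zeros (harm_poly n m (a(0 := y)) b) T \<partial>cgauss_measure v) =
     (\<integral>\<^sup>+y. emeasure (count_space UNIV) {z\<in>T. - F z = y} * ennreal (cgauss v y) \<partial>lborel)"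
    unfolding count by (rule nn_integral_cgauss_measure) (rule meas)
  also have "\<dots> = (\<integral>\<^sup>+z\<in>T. ennreal (cgauss v (- F z)) * ennreal \<bar>(cmod (- p z))\<^sup>2 - (cmod (- q z))\<^sup>2\<bar> \<partial>lborel)"
  proof (rule area_formula_complex[where p = "\<lambda>z. - p z" and q = "\<lambda>z. - q z", OF _ _ _ T])
    show "((\<lambda>z. - F z) has_derivative (\<lambda>h. - p z * h + - q z * cnj h)) (at z)" for z
      using has_derivative_minus[OF has_derivative_harm[of a "{1..n}" b "{..m}" z]]
      unfolding F_def p_def q_def by (simp add: minus_mult_left[symmetric] del: minus_mult_left[symmetric])
  qed (use cont in \<open>auto intro!: continuous_intros\<close>)
  finally show ?thesis unfolding cgauss_uminus norm_minus_cancel F_def p_def q_def .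
qed

theorem theorem2p1:
  fixes M :: "'a measure" and A B :: "nat \<Rightarrow> 'a \<Rightarrow> complex"
    and \<alpha> \<beta> :: "nat \<Rightarrow> real" and n m :: nat and T :: "complex set"
  assumes "prob_space M"
    and "1 \<le> m" and "m \<le> n"
    and "\<And>j. j \<le> n \<Longrightarrow> \<alpha> j > 0"
    and "\<And>j. j \<le> m \<Longrightarrow> \<beta> j > 0"
    and "\<And>j. j \<le> n \<Longrightarrow> complex_gaussian M (A j) (\<alpha> j)"
    and "\<And>j. j \<le> m \<Longrightarrow> complex_gaussian M (B j) (\<beta> j)"
    and "prob_space.indep_vars M (\<lambda>_. borel)
           (\<lambda>i. case i of Inl j \<Rightarrow> A j | Inr j \<Rightarrow> B j) ({..n} <+> {..m})"
    and "open T"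
  shows "(\<integral>\<^sup>+ \<omega>. num_zeros (harm_poly n m (\<lambda>j. A j \<omega>) (\<lambda>j. B j \<omega>)) T \<partial>M)
         = (\<integral>\<^sup>+ z \<in> T. ennreal (zero_density n m \<alpha> \<beta> z) \<partial>lborel)"
proof -
  interpret prob_space M by fact
  define X where "X = (\<lambda>i. case i of Inl j \<Rightarrow> A j | Inr j \<Rightarrow> B j)"
  define I :: "(nat + nat) set" where "I = {..n} <+> {..m}"
  \<comment> \<open>All indices except that of the constant coefficient, which will be the innermost
    variable of integration.\<close>
  define I' :: "(nat + nat) set" where "I' = Inl ` {1..n} \<union> Inr ` {..m}"
  define \<gamma> where "\<gamma> i = cgauss_measure (case_sum \<alpha> \<beta> i)" for i :: "nat + nat"
  interpret G: product_sigma_finite \<gamma>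
    unfolding \<gamma>_def by (rule product_sigma_finite_cgauss)
  have sets_\<gamma> [measurable_cong]: "sets (\<gamma> i) = sets borel" for i by (simp add: \<gamma>_def)
  have I_eq: "I = insert (Inl 0) I'" and finI': "finite I'" and notin: "Inl 0 \<notin> I'"
  proof -
    have "{..n} = insert 0 {1..n}" by auto
    then show "I = insert (Inl 0) I'" by (simp add: I_def I'_def Plus_def)
  qed (auto simp: I'_def)
  interpret G': finite_product_sigma_finite \<gamma> I' by standard (rule finI')
  interpret P: pair_sigma_finite "PiM I' \<gamma>" "lborel :: complex measure" ..
  have [measurable]: "T \<in> sets borel" using assms(9) by simp
  have cg: "random_variable borel Y \<and> distr M borel Y = cgauss_measure w"
    if "complex_gaussian M Y w" for Y w
  proof -
    have "distributed M lborel Y (\<lambda>z. ennreal (cgauss w z))"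
      using that by (simp add: complex_gaussian_def cgauss_def)
    then have Y: "random_variable lborel Y" "distr M lborel Y = cgauss_measure w"
      by (auto simp: distributed_def cgauss_measure_def)
    moreover have "distr M borel Y = distr M lborel Y" by (rule distr_cong) auto
    ultimately show ?thesis by simp
  qed
  have X: "random_variable borel (X i)" "distr M borel (X i) = \<gamma> i" if "i \<in> I" for i
    using that cg[OF assms(6)] cg[OF assms(7)] by (auto simp: I_def X_def \<gamma>_def)
  have XI: "(\<lambda>\<omega>. \<lambda>i\<in>I. X i \<omega>) \<in> measurable M (PiM I (\<lambda>_. borel))"
    using X by (intro measurable_restrict) auto
  \<comment> \<open>The only place where independence enters: the joint law of the coefficients is
    the product of their laws.\<close>
  have law: "distr M (PiM I (\<lambda>_. borel)) (\<lambda>\<omega>. \<lambda>i\<in>I. X i \<omega>) = PiM I \<gamma>"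
  proof -
    have "I \<noteq> {}" by (simp add: I_eq)
    then have "distr M (PiM I (\<lambda>_. borel)) (\<lambda>\<omega>. \<lambda>i\<in>I. X i \<omega>) = PiM I (\<lambda>i. distr M borel (X i))"
      using indep_vars_iff_distr_eq_PiM'[where I = I and M' = "\<lambda>_. borel" and X = X] X(1) assms(8)
      by (simp add: X_def[symmetric] I_def[symmetric])
    also have "\<dots> = PiM I \<gamma>" using X(2) by (intro PiM_cong) auto
    finally show ?thesis .
  qed
  \<comment> \<open>The zero count as a function of the coefficient vector. It reads only
    coordinates in \<open>I\<close>, so restricting the family to \<open>I\<close> does not change
    it.\<close>
  define N where "N x = num_zeros (harm_poly n m (\<lambda>j. x (Inl j)) (\<lambda>j. x (Inr j))) T" for x :: "nat + nat \<Rightarrow> complex"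
  have N: "N \<in> borel_measurable (PiM I (\<lambda>_. borel))"
    unfolding N_def num_zeros_eq_count
  proof (rule borel_measurable_count_zeros[OF _ _ assms(9)])
    show "continuous_on UNIV (harm_poly n m (\<lambda>j. x (Inl j)) (\<lambda>j. x (Inr j)))" for x :: "nat + nat \<Rightarrow> complex"
      unfolding harm_poly_def by (intro continuous_intros)
    show "(\<lambda>x. harm_poly n m (\<lambda>j. x (Inl j)) (\<lambda>j. x (Inr j)) z) \<in> borel_measurable (PiM I (\<lambda>_. borel))" for z
      unfolding harm_poly_def
      by (auto simp: I_def intro!: borel_measurable_add borel_measurable_sum borel_measurable_times measurable_component_singleton)
  qed
  have "sets (PiM I \<gamma>) = sets (PiM I (\<lambda>_. borel))"
    by (intro sets_PiM_cong) (auto simp: \<gamma>_def)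
  then have N' [measurable]: "N \<in> borel_measurable (PiM (insert (Inl 0) I') \<gamma>)"
    using N unfolding I_eq[symmetric] by (simp cong: measurable_cong_sets)
  let ?f = "\<lambda>x z. ennreal (cgauss (\<alpha> 0) ((\<Sum>j=1..n. x (Inl j) * z ^ j) + (\<Sum>j\<le>m. x (Inr j) * cnj z ^ j))) *
      ennreal \<bar>(cmod (\<Sum>j=1..n. of_nat j * x (Inl j) * z ^ (j - 1)))\<^sup>2 -
        (cmod (\<Sum>j\<le>m. of_nat j * x (Inr j) * cnj z ^ (j - 1)))\<^sup>2\<bar>"
  have comp: "(\<lambda>x. x i) \<in> borel_measurable (PiM I' \<gamma>)" if "i \<in> I'" for i
    using measurable_component_singleton[OF that, of \<gamma>]
    unfolding measurable_cong_sets[OF refl sets_\<gamma>] .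
  have [measurable]: "(\<lambda>w. fst w (Inl j)) \<in> borel_measurable (PiM I' \<gamma> \<Otimes>\<^sub>M lborel)" if "j \<in> {1..n}" for j
    using that by (intro measurable_compose[OF measurable_fst comp]) (auto simp: I'_def)
  have [measurable]: "(\<lambda>w. fst w (Inr j)) \<in> borel_measurable (PiM I' \<gamma> \<Otimes>\<^sub>M lborel)" if "j \<in> {..m}" for j
    using that by (intro measurable_compose[OF measurable_fst comp]) (auto simp: I'_def)
  have "(\<integral>\<^sup>+ \<omega>. num_zeros (harm_poly n m (\<lambda>j. A j \<omega>) (\<lambda>j. B j \<omega>)) T \<partial>M) = (\<integral>\<^sup>+ \<omega>. N (\<lambda>i\<in>I. X i \<omega>) \<partial>M)"
  proof (rule nn_integral_cong)
    fix \<omega>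
    have "harm_poly n m (\<lambda>j. A j \<omega>) (\<lambda>j. B j \<omega>) =
        harm_poly n m (\<lambda>j. (\<lambda>i\<in>I. X i \<omega>) (Inl j)) (\<lambda>j. (\<lambda>i\<in>I. X i \<omega>) (Inr j))"
      by (auto simp: harm_poly_def fun_eq_iff X_def I_def intro!: arg_cong2[where f = "(+)"] sum.cong)
    then show "num_zeros (harm_poly n m (\<lambda>j. A j \<omega>) (\<lambda>j. B j \<omega>)) T = N (\<lambda>i\<in>I. X i \<omega>)"
      by (simp only: N_def)
  qed
  also have "\<dots> = (\<integral>\<^sup>+x. N x \<partial>PiM I \<gamma>)"
    unfolding law[symmetric] by (rule nn_integral_distr[OF XI, symmetric]) (simp add: N)
  also have "\<dots> = (\<integral>\<^sup>+x. \<integral>\<^sup>+y. N (x(Inl 0 := y)) \<partial>\<gamma> (Inl 0) \<partial>PiM I' \<gamma>)"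
    unfolding I_eq by (rule G.product_nn_integral_insert[OF finI' notin N'])
  also have "\<dots> = (\<integral>\<^sup>+x. \<integral>\<^sup>+z. ?f x z * indicator T z \<partial>lborel \<partial>PiM I' \<gamma>)"
  proof (rule nn_integral_cong)
    fix x :: "nat + nat \<Rightarrow> complex"
    have "N (x(Inl 0 := y)) = num_zeros (harm_poly n m ((\<lambda>j. x (Inl j))(0 := y)) (\<lambda>j. x (Inr j))) T" for y
      unfolding N_def by (intro arg_cong2[where f = num_zeros] refl) (auto simp: harm_poly_def fun_eq_iff intro!: arg_cong2[where f = "(+)"] sum.cong)
    then show "(\<integral>\<^sup>+y. N (x(Inl 0 := y)) \<partial>\<gamma> (Inl 0)) = (\<integral>\<^sup>+z. ?f x z * indicator T z \<partial>lborel)"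
      unfolding \<gamma>_def sum.case using nn_integral_num_zeros_constant_term[OF assms(9)] by simp
  qed
  \<comment> \<open>Everything is nonnegative and both measures are sigma-finite, so joint
    measurability suffices for the exchange.\<close>
  also have "\<dots> = (\<integral>\<^sup>+z. \<integral>\<^sup>+x. ?f x z * indicator T z \<partial>PiM I' \<gamma> \<partial>lborel)"
    by (rule P.Fubini'[symmetric]) measurable
  also have "\<dots> = (\<integral>\<^sup>+ z \<in> T. ennreal (zero_density n m \<alpha> \<beta> z) \<partial>lborel)"
  proof (rule nn_integral_cong_AE)
    have eq: "(\<integral>\<^sup>+x. ?f x z * indicator T z \<partial>PiM I' \<gamma>) = ennreal (zero_density n m \<alpha> \<beta> z) * indicator T z"
      if "z \<noteq> 0" for z
    proof -
      have "(\<integral>\<^sup>+x. ?f x z \<partial>PiM I' \<gamma>) = ennreal (zero_density n m \<alpha> \<beta> z)"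
        unfolding I'_def \<gamma>_def using assms(2-5) that by (intro nn_integral_density_at) auto
      then show ?thesis by (cases "z \<in> T") auto
    qed
    \<comment> \<open>The average at a point is known for z \<noteq> 0, and the origin is a null
      set.\<close>
    show "AE z in lborel. (\<integral>\<^sup>+x. ?f x z * indicator T z \<partial>PiM I' \<gamma>) = ennreal (zero_density n m \<alpha> \<beta> z) * indicator T z"
      using AE_lborel_singleton[of 0] by eventually_elim (rule eq)
  qed
  finally show ?thesis .
qed

end
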